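(* Job Interval Selection on proper interval graphs admits a problem kernel with at most $4k^2\cdot\omega$ intervals that is computable in $O(n)$ time, where $\omega$ is the maximum clique size of the input graph, $k$ is the sought solution size, and $n$ is the number of input intervals.
   Context: Job Interval Selection: given an interval graph $G=(V,E)$, a coloring $\mathrm{col}\colon V\to\{1,\dots,\gamma\}$, and a natural number $k$, decide whether $G$ has a colorful independent set of size $k$, where an independent set is colorful if no two of its vertices have the same color. $n=|V|$. A proper interval graph is a graph having a representation by closed intervals on the real line in which no interval is properly contained in another (equivalently, an interval graph with no induced $K_{1,3}$). It is assumed that the input graph is given by an interval representation with start and end points in $\{1,\dots,c\}$ for the minimum possible $c$, with intervals sorted by increasing start points. A problem kernel with at most $s$ intervals, computable in time $t$, means: there is an algorithm running in time $t$ that maps each instance $(G,\mathrm{col},k)$ to an equivalent instance $(G',\mathrm{col}',k')$ of the same problem (one is a yes-instance if and only if the other is), where $G'$ has at most $s$ vertices and the parameters of the new instance are bounded by a function of the parameters of the old one. *)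

theory Defs
  imports Complex_Main "HOL-Library.Landau_Symbols"
begin

section \<open>Graphs and interval representations\<close>

type_synonym 'v graph = "'v set \<times> 'v set set"

definition verts :: "'v graph \<Rightarrow> 'v set" where
  "verts G = fst G"

definition adj :: "'v graph \<Rightarrow> 'v \<Rightarrow> 'v \<Rightarrow> bool" where
  "adj G u v \<longleftrightarrow> {u, v} \<in> snd G"

definition clique :: "'v graph \<Rightarrow> 'v set \<Rightarrow> bool" where
  "clique G K \<longleftrightarrow> K \<subseteq> verts G \<and> (\<forall>u\<in>K. \<forall>v\<in>K. u \<noteq> v \<longrightarrow> adj G u v)"

definition independent :: "'v graph \<Rightarrow> 'v set \<Rightarrow> bool" where
  "independent G S \<longleftrightarrow> S \<subseteq> verts G \<and> (\<forall>u\<in>S. \<forall>v\<in>S. u \<noteq> v \<longrightarrow> \<not> adj G u v)"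

text \<open>For finite graphs only, where the set is finite and contains \<open>card {} = 0\<close>.\<close>

definition clique_number :: "'v graph \<Rightarrow> nat" where
  "clique_number G = Max (card ` {K. clique G K})"

text \<open>The graph on \<open>V\<close> in which distinct vertices are adjacent iff their closed intervals
  \<open>{l v..r v}\<close> meet.\<close>

definition intersection_graph ::
    "'v set \<Rightarrow> ('v \<Rightarrow> 'a::linorder) \<Rightarrow> ('v \<Rightarrow> 'a) \<Rightarrow> 'v graph" where
  "intersection_graph V l r =
    (V, {{u, v} | u v. u \<in> V \<and> v \<in> V \<and> u \<noteq> v \<and> {l u..r u} \<inter> {l v..r v} \<noteq> {}})"

definition interval_representation ::
    "'v graph \<Rightarrow> ('v \<Rightarrow> 'a::linorder) \<Rightarrow> ('v \<Rightarrow> 'a) \<Rightarrow> bool" where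
  "interval_representation G l r \<longleftrightarrow>
    (\<forall>v\<in>verts G. l v \<le> r v) \<and> G = intersection_graph (verts G) l r"

definition proper_interval_graph :: "'v graph \<Rightarrow> bool" where
  "proper_interval_graph G \<longleftrightarrow>
    (\<exists>l r :: 'v \<Rightarrow> real. interval_representation G l r \<and>
      (\<forall>u\<in>verts G. \<forall>v\<in>verts G. \<not> {l u..r u} \<subset> {l v..r v}))"

text \<open>Integer endpoints in \<open>{1..c}\<close>. Such intervals meet as sets of naturals iff they meet as
  real intervals.\<close>

definition representation_upto ::
    "'v graph \<Rightarrow> nat \<Rightarrow> ('v \<Rightarrow> nat) \<Rightarrow> ('v \<Rightarrow> nat) \<Rightarrow> bool" where
  "representation_upto G c l r \<longleftrightarrow>
    interval_representation G l r \<and> (\<forall>v\<in>verts G. l v \<in> {1..c} \<and> r v \<in> {1..c})"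

definition minimum_representation :: "'v graph \<Rightarrow> ('v \<Rightarrow> nat) \<Rightarrow> ('v \<Rightarrow> nat) \<Rightarrow> bool" where
  "minimum_representation G l r \<longleftrightarrow>
    (\<exists>c. representation_upto G c l r \<and> (\<forall>c' l' r'. representation_upto G c' l' r' \<longrightarrow> c \<le> c'))"

section \<open>Job Interval Selection\<close>

text \<open>The vertices are the positions in the list \<open>jobs\<close> of triples (start, end, color);
  colors are taken from \<open>{1..num_colors}\<close>, and \<open>target\<close> is the sought solution size.\<close>

record jis =
  jobs :: "(nat \<times> nat \<times> nat) list"
  num_colors :: nat
  target :: nat

definition num_jobs :: "jis \<Rightarrow> nat" where
  "num_jobs x = length (jobs x)"

definition start_of :: "jis \<Rightarrow> nat \<Rightarrow> nat" where
  "start_of x v = fst (jobs x ! v)"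

definition end_of :: "jis \<Rightarrow> nat \<Rightarrow> nat" where
  "end_of x v = fst (snd (jobs x ! v))"

definition color_of :: "jis \<Rightarrow> nat \<Rightarrow> nat" where
  "color_of x v = snd (snd (jobs x ! v))"

definition jis_graph :: "jis \<Rightarrow> nat graph" where
  "jis_graph x = intersection_graph {..<num_jobs x} (start_of x) (end_of x)"

definition jis_instance :: "jis \<Rightarrow> bool" where
  "jis_instance x \<longleftrightarrow>
    minimum_representation (jis_graph x) (start_of x) (end_of x) \<and>
    sorted (map fst (jobs x)) \<and>
    (\<forall>v\<in>verts (jis_graph x). color_of x v \<in> {1..num_colors x})"

definition proper_jis_instance :: "jis \<Rightarrow> bool" where
  "proper_jis_instance x \<longleftrightarrow> jis_instance x \<and> proper_interval_graph (jis_graph x)"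

definition colorful_independent :: "'v graph \<Rightarrow> ('v \<Rightarrow> nat) \<Rightarrow> 'v set \<Rightarrow> bool" where
  "colorful_independent G col S \<longleftrightarrow> independent G S \<and> inj_on col S"

definition jis_yes :: "jis \<Rightarrow> bool" where
  "jis_yes x \<longleftrightarrow>
    (\<exists>S. colorful_independent (jis_graph x) (color_of x) S \<and> card S = target x)"

section \<open>Random access machine with unit costs\<close>

text \<open>A structured form of the Cook--Reckhow random access machine: finitely many directly
  addressed registers (a program mentions only finitely many), an infinite memory accessed
  indirectly through registers, and unit cost for each instruction and each evaluation of a loop
  or branch condition. The only arithmetic is addition and truncated subtraction, so that unit
  costs do not hide large computations (no multiplication). Tests are for a register being
  nonzero. Replacing the control structures by jumps changes the number of steps only by a
  constant factor.\<close>

datatype com =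
    Skip
  | Const nat nat       \<comment> \<open>\<open>Const a n\<close>: register \<open>a\<close> gets the fixed number \<open>n\<close>\<close>
  | Add nat nat nat     \<comment> \<open>\<open>Add a b c\<close>: register \<open>a\<close> gets the sum of registers \<open>b\<close> and \<open>c\<close>\<close>
  | Sub nat nat nat
  | Load nat nat        \<comment> \<open>\<open>Load a b\<close>: register \<open>a\<close> gets the memory cell addressed by register \<open>b\<close>\<close>
  | Store nat nat       \<comment> \<open>\<open>Store a b\<close>: the memory cell addressed by register \<open>a\<close> gets register \<open>b\<close>\<close>
  | Seq com com
  | If nat com com
  | While nat com

type_synonym state = "(nat \<Rightarrow> nat) \<times> (nat \<Rightarrow> nat)"

text \<open>\<open>exec p s t s'\<close>: started in state \<open>s\<close> (registers, memory), \<open>p\<close> halts after \<open>t\<close> steps in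
  state \<open>s'\<close>.\<close>

inductive exec :: "com \<Rightarrow> state \<Rightarrow> nat \<Rightarrow> state \<Rightarrow> bool" where
  Skip: "exec Skip s 1 s"
| Const: "exec (Const a n) (R, M) 1 (R(a := n), M)"
| Add: "exec (Add a b c) (R, M) 1 (R(a := R b + R c), M)"
| Sub: "exec (Sub a b c) (R, M) 1 (R(a := R b - R c), M)"
| Load: "exec (Load a b) (R, M) 1 (R(a := M (R b)), M)"
| Store: "exec (Store a b) (R, M) 1 (R, M(R a := R b))"
| Seq: "exec p s t s' \<Longrightarrow> exec q s' u s'' \<Longrightarrow> exec (Seq p q) s (t + u) s''"
| IfTrue: "R a \<noteq> 0 \<Longrightarrow> exec p (R, M) t s' \<Longrightarrow> exec (If a p q) (R, M) (Suc t) s'"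
| IfFalse: "R a = 0 \<Longrightarrow> exec q (R, M) t s' \<Longrightarrow> exec (If a p q) (R, M) (Suc t) s'"
| WhileTrue: "R a \<noteq> 0 \<Longrightarrow> exec p (R, M) t s' \<Longrightarrow> exec (While a p) s' u s''
    \<Longrightarrow> exec (While a p) (R, M) (Suc (t + u)) s''"
| WhileFalse: "R a = 0 \<Longrightarrow> exec (While a p) (R, M) 1 (R, M)"

inductive_cases exec_elims:
  "exec Skip s t s'" "exec (Const a n) s t s'" "exec (Add a b c) s t s'"
  "exec (Sub a b c) s t s'" "exec (Load a b) s t s'" "exec (Store a b) s t s'"
  "exec (Seq p q) s t s'" "exec (If a p q) s t s'" "exec (While a p) s t s'"

lemma exec_deterministic:
  "exec p s t s' \<Longrightarrow> exec p s u s'' \<Longrightarrow> u = t \<and> s'' = s'"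
proof (induction arbitrary: u s'' rule: exec.induct)
  case (Seq p s t s' q u s'' v s3)
  from Seq.prems show ?case by (rule exec_elims) (use Seq.IH in blast)
next
  case (IfTrue R a p M t s' q)
  from IfTrue.prems show ?case by (rule exec_elims) (use IfTrue.IH IfTrue.hyps in fastforce)+
next
  case (IfFalse R a q M t s' p)
  from IfFalse.prems show ?case by (rule exec_elims) (use IfFalse.IH IfFalse.hyps in fastforce)+
next
  case (WhileTrue R a p M t s' u s'')
  from WhileTrue.prems show ?case
    by (rule exec_elims) (use WhileTrue.IH WhileTrue.hyps in fastforce)+
next
  case (WhileFalse R a p M)
  from WhileFalse.prems show ?case by (rule exec_elims) (use WhileFalse.hyps in fastforce)+
qed (erule exec_elims; simp)+

text \<open>The input is stored from address 0 on; all other cells and all registers are initially 0.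
  The output, too, is read from address 0 on. Cells beyond it are ignored, so the encoding of
  outputs has to be self-delimiting.\<close>

definition runs_within :: "com \<Rightarrow> nat list \<Rightarrow> nat list \<Rightarrow> nat \<Rightarrow> bool" where
  "runs_within p xs ys b \<longleftrightarrow>
    (\<exists>t R M. t \<le> b \<and>
      exec p (\<lambda>_. 0, \<lambda>i. if i < length xs then xs ! i else 0) t (R, M) \<and>
      (\<forall>i<length ys. M i = ys ! i))"

definition encode :: "jis \<Rightarrow> nat list" where
  "encode x = [target x, num_colors x, num_jobs x] @
    concat (map (\<lambda>(s, e, c). [s, e, c]) (jobs x))"

section \<open>Problem kernels\<close>

text \<open>\<open>p\<close> computes a problem kernel for Job Interval Selection on proper interval graphs with at
  most \<open>s x\<close> intervals in time \<open>T n\<close>, where \<open>n\<close> is the number of input intervals.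
  The parameters are the solution size and the maximum clique size; \<open>g\<close> bounds them in the new
  instance. The number of colors is not a parameter of this kernel, but must not grow arbitrarily
  either, which is what \<open>h\<close> expresses.\<close>

definition computes_jis_kernel :: "com \<Rightarrow> (nat \<Rightarrow> nat) \<Rightarrow> (jis \<Rightarrow> nat) \<Rightarrow> bool" where
  "computes_jis_kernel p T s \<longleftrightarrow>
    (\<exists>(g :: nat \<Rightarrow> nat \<Rightarrow> nat) (h :: nat \<Rightarrow> nat \<Rightarrow> nat \<Rightarrow> nat).
      \<forall>x. proper_jis_instance x \<longrightarrow>
        (\<exists>x'. proper_jis_instance x' \<and>
          runs_within p (encode x) (encode x') (T (num_jobs x)) \<and>
          (jis_yes x \<longleftrightarrow> jis_yes x') \<and>
          card (verts (jis_graph x')) \<le> s x \<and>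
          target x' \<le> g (target x) (clique_number (jis_graph x)) \<and>
          clique_number (jis_graph x') \<le> g (target x) (clique_number (jis_graph x)) \<and>
          num_colors x' \<le> h (target x) (clique_number (jis_graph x)) (num_colors x)))"

end

theory Submission
  imports Defs
begin

text \<open>
  Scan the intervals by increasing start point and pick greedily a colorful independent set \<open>J\<close>. If
  \<open>J\<close> has \<open>k\<close> elements, then the answer is yes, and the empty instance with target \<open>0\<close> is
  output. Otherwise every interval has the color of an element of \<open>J\<close> or meets an element of \<open>J\<close>.

  A second scan splits the intervals of each color into groups: an interval opens a new group if it
  starts behind the smallest end point of the current one. Each group is a clique, and the intervals
  with the smallest end points of their groups are pairwise disjoint. Only the first \<open>2 k - 1\<close>
  groups of each color are kept. This preserves solutions: an interval of a proper interval graph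
  meets at most two of the representatives of the \<open>2 k - 1\<close> groups, so that the other \<open>k - 1\<close>
  intervals of a solution leave one representative free, which can replace a dropped interval. At most
  \<open>(2 k - 1) \<omega>\<close> intervals of each color remain, and at most \<open>2 \<omega>\<close> intervals meet a given one, so
  \<open>(k - 1) ((2 k - 1) \<omega> + 2 \<omega>) \<le> 4 k\<^sup>2 \<omega>\<close> intervals remain altogether.

  The remaining intervals are brought into a minimum representation by contracting the coordinates,
  opening a new coordinate only at a start point that follows an end point.
\<close>

section \<open>Loop-free programs and counting loops\<close>

fun loop_free :: "com \<Rightarrow> bool" where
  "loop_free (Seq p q) \<longleftrightarrow> loop_free p \<and> loop_free q"
| "loop_free (If a p q) \<longleftrightarrow> loop_free p \<and> loop_free q"
| "loop_free (While a p) \<longleftrightarrow> False"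
| "loop_free _ \<longleftrightarrow> True"

text \<open>Both branches are added up, so that the bound does not depend on the state.\<close>

fun cost :: "com \<Rightarrow> nat" where
  "cost (Seq p q) = cost p + cost q"
| "cost (If a p q) = Suc (cost p + cost q)"
| "cost _ = 1"

fun run :: "com \<Rightarrow> state \<Rightarrow> state" where
  "run (Const a m) (R, M) = (R(a := m), M)"
| "run (Add a b c) (R, M) = (R(a := R b + R c), M)"
| "run (Sub a b c) (R, M) = (R(a := R b - R c), M)"
| "run (Load a b) (R, M) = (R(a := M (R b)), M)"
| "run (Store a b) (R, M) = (R, M(R a := R b))"
| "run (Seq p q) st = run q (run p st)"
| "run (If a p q) (R, M) = (if R a \<noteq> 0 then run p (R, M) else run q (R, M))"
| "run _ st = st"

lemma exec_run: "loop_free p \<Longrightarrow> \<exists>t\<le>cost p. exec p st t (run p st)"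
proof (induction p st rule: run.induct)
  case (6 p q st)
  then obtain t u where "t \<le> cost p" "exec p st t (run p st)"
      "u \<le> cost q" "exec q (run p st) u (run q (run p st))"
    by auto
  then show ?case
    by (intro exI[of _ "t + u"]) (auto intro: exec.Seq)
next
  case (7 a p q R M)
  show ?case
  proof (cases "R a = 0")
    case True
    with 7 obtain t where "t \<le> cost q" "exec q (R, M) t (run q (R, M))" by auto
    with True show ?thesis by (intro exI[of _ "Suc t"]) (auto intro: exec.IfFalse)
  next
    case False
    with 7 obtain t where "t \<le> cost p" "exec p (R, M) t (run p (R, M))" by auto
    with False show ?thesis by (intro exI[of _ "Suc t"]) (auto intro: exec.IfTrue)
  qed
qed (auto intro!: exI[of _ "Suc 0"] exec.intros[unfolded One_nat_def])

text \<open>Total correctness with a time bound, for one fixed start state.\<close>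

definition reaches :: "com \<Rightarrow> state \<Rightarrow> nat \<Rightarrow> (state \<Rightarrow> bool) \<Rightarrow> bool" where
  "reaches p st b Q \<longleftrightarrow> (\<exists>t st'. t \<le> b \<and> exec p st t st' \<and> Q st')"

lemma reaches_run:
  assumes "loop_free p" "Q (run p st)"
  shows "reaches p st (cost p) Q"
  using exec_run[OF assms(1), of st] assms(2) unfolding reaches_def by blast

lemma reaches_Seq:
  assumes "reaches p st b P" and "\<And>st'. P st' \<Longrightarrow> reaches q st' d Q"
  shows "reaches (Seq p q) st (b + d) Q"
proof -
  obtain t st' where "t \<le> b" "exec p st t st'" "P st'"
    using assms(1) unfolding reaches_def by blast
  moreover obtain u st'' where "u \<le> d" "exec q st' u st''" "Q st''"
    using assms(2)[OF \<open>P st'\<close>] unfolding reaches_def by blast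
  ultimately show ?thesis
    unfolding reaches_def by (meson add_mono exec.Seq)
qed

text \<open>The invariant carries the number of completed iterations and thus fixes when the loop
  stops. Each iteration costs the body and one test; the final \<open>1\<close> pays for the failing
  test.\<close>

lemma reaches_While:
  assumes body: "\<And>i st. i < N \<Longrightarrow> Inv i st \<Longrightarrow> fst st a \<noteq> 0 \<and> Inv (Suc i) (run p st)"
    and exit: "\<And>st. Inv N st \<Longrightarrow> fst st a = 0"
    and "loop_free p" "i \<le> N" "Inv i st"
  shows "reaches (While a p) st ((N - i) * Suc (cost p) + 1) (Inv N)"
  using \<open>i \<le> N\<close> \<open>Inv i st\<close>
proof (induction i arbitrary: st rule: inc_induct)
  case base
  obtain R M where st: "st = (R, M)" by fastforce
  show ?case
    unfolding reaches_def using exec.WhileFalse[of R a p M] exit[OF base] base st by auto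
next
  case (step i)
  obtain R M where st: "st = (R, M)" by fastforce
  obtain t where t: "t \<le> cost p" "exec p st t (run p st)"
    using exec_run[OF \<open>loop_free p\<close>] by blast
  have inv: "fst st a \<noteq> 0" "Inv (Suc i) (run p st)"
    using body[OF step.hyps(2) step.prems] by auto
  obtain u st' where u: "u \<le> (N - Suc i) * Suc (cost p) + 1"
      "exec (While a p) (run p st) u st'" "Inv N st'"
    using step.IH[OF inv(2)] unfolding reaches_def by blast
  have "exec (While a p) st (Suc (t + u)) st'"
    using exec.WhileTrue t(2) u(2) inv(1) st by auto
  moreover have "N - i = Suc (N - Suc i)" using step.hyps by simp
  then have "Suc (t + u) \<le> (N - i) * Suc (cost p) + 1"
    using t(1) u(1) by simp
  ultimately show ?case
    unfolding reaches_def using u(3) by blast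
qed

section \<open>The kernelization algorithm\<close>

locale job_list =
  fixes n k C :: nat and s e c :: "nat \<Rightarrow> nat"
begin

text \<open>The second component is the end point of the interval picked last. Before the first pick
  it is 0, below the positive start points of \<open>sorted_job_list\<close>.\<close>

primrec greedy :: "nat \<Rightarrow> nat set \<times> nat" where
  "greedy 0 = ({}, 0)"
| "greedy (Suc i) = (let (J, l) = greedy i in
     if c i \<notin> c ` J \<and> l < s i then (insert i J, e i) else (J, l))"

text \<open>For each color, the number of groups opened so far and the smallest end point in the
  current one. For positive start points, the initial pair makes the first interval of a color open
  group 1.\<close>

primrec groups :: "nat \<Rightarrow> nat \<Rightarrow> nat \<times> nat" where
  "groups 0 = (\<lambda>_. (0, 0))"
| "groups (Suc i) = (groups i)(c i := let (g, l) = groups i (c i) in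
     if l < s i then (Suc g, e i) else (g, min l (e i)))"

definition group :: "nat \<Rightarrow> nat" where
  "group v = fst (groups (Suc v) (c v))"

definition kept :: "nat \<Rightarrow> nat \<Rightarrow> nat list" where
  "kept b i = filter (\<lambda>v. group v \<le> b) [0..<i]"

definition new_target :: nat where
  "new_target = (if k \<le> card (fst (greedy n)) then 0 else k)"

text \<open>For target 0, truncated subtraction gives 0. As groups are numbered from 1, nothing is
  kept then, and the trivial yes-instance results.\<close>

definition bound :: nat where
  "bound = 2 * new_target - 1"

definition kept_list :: "nat list" where
  "kept_list = kept bound n"

end

text \<open>The bound \<open>e v \<le> n\<close> will come from the minimality of the
  representation; it makes a pass over all coordinates linear in the number of jobs.\<close>

locale sorted_job_list = job_list +
  assumes s_le_e: "v < n \<Longrightarrow> s v \<le> e v"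
    and s_pos: "v < n \<Longrightarrow> 0 < s v"
    and e_le: "v < n \<Longrightarrow> e v \<le> n"
    and s_mono: "u \<le> v \<Longrightarrow> v < n \<Longrightarrow> s u \<le> s v"

text \<open>The second component says whether the current coordinate is open: no point of \<open>E\<close> has occurred
  since the point of \<open>S\<close> that created it.\<close>

fun compress :: "nat set \<Rightarrow> nat set \<Rightarrow> nat \<Rightarrow> nat \<times> bool" where
  "compress S E 0 = (0, False)"
| "compress S E (Suc p) = (let (q, f) = compress S E p; f' = (f \<or> Suc p \<in> S) in
     (if Suc p \<in> S \<and> \<not> f then Suc q else q, f' \<and> Suc p \<notin> E))"

context job_list
begin

abbreviation sweep :: "nat \<Rightarrow> nat \<times> bool" where
  "sweep \<equiv> compress (s ` set kept_list) (e ` set kept_list)"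

end

section \<open>The machine program\<close>

text \<open>Memory layout: field \<open>j\<close> of job \<open>v\<close> is at \<open>job j v\<close>. Six interleaved arrays, unbounded as colors are,
  begin behind the input, at the address \<open>b\<close> held in register 6; entry \<open>v\<close> of the array \<open>j\<close> is at
  \<open>cell b j v\<close>. Array 0 marks the colors of the greedy set, arrays 1 and 2 hold the number of groups of
  a color and the smallest end point of the current one, arrays 3 and 4 mark the start and end points of
  kept intervals, and array 5 holds the new coordinates.

  Registers: 0 and 1 hold the constants 0 and 1, 4 the target, 5 the number of jobs, 7 the
  loop index, 8 the remaining iterations, 10 to 12 the current job, 17 the size of the greedy set, 18
  the bound on the number of groups, 20 the number of kept jobs; 21 and 22 hold the state of
  \<open>compress\<close>; the others are temporary.\<close>

definition job :: "nat \<Rightarrow> nat \<Rightarrow> nat" where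
  "job j v = 3 + 3 * v + j"

definition cell :: "nat \<Rightarrow> nat \<Rightarrow> nat \<Rightarrow> nat" where
  "cell b j v = b + 6 * v + j"

text \<open>These rules and those below separate addresses, so that the simplifier can evaluate the
  memory after a sequence of writes.\<close>

lemma job_eq_iff [simp]: "i < 3 \<Longrightarrow> j < 3 \<Longrightarrow> job i u = job j v \<longleftrightarrow> i = j \<and> u = v"
  unfolding job_def by presburger

lemma cell_eq_iff [simp]: "i < 6 \<Longrightarrow> j < 6 \<Longrightarrow> cell b i u = cell b j v \<longleftrightarrow> i = j \<and> u = v"
  unfolding cell_def by presburger

lemma job_neq_cell [simp]:
  "v < n \<Longrightarrow> i < 3 \<Longrightarrow> job i v \<noteq> cell (3 + 3 * n) j u"
  "v < n \<Longrightarrow> i < 3 \<Longrightarrow> cell (3 + 3 * n) j u \<noteq> job i v"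
  unfolding job_def cell_def by linarith+

lemma address_neq_1 [simp]:
  "job i v \<noteq> Suc 0" "Suc 0 \<noteq> job i v"
  "cell (3 + 3 * n) j u \<noteq> Suc 0" "Suc 0 \<noteq> cell (3 + 3 * n) j u"
  unfolding job_def cell_def by linarith+

text \<open>Lacking multiplication, the machine obtains the factor 3, and 6 in
  \<open>get_cell\<close>, by repeated addition.\<close>

definition get_job :: "nat \<Rightarrow> nat \<Rightarrow> nat \<Rightarrow> com" where
  "get_job d a j = Seq (Const d (3 + j)) (Seq (Add d d a) (Seq (Add d d a) (Add d d a)))"

definition get_cell :: "nat \<Rightarrow> nat \<Rightarrow> nat \<Rightarrow> com" where
  "get_cell d a j = Seq (Const d j) (Seq (Add d d 6) (Seq (Add d d a) (Seq (Add d d a)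
     (Seq (Add d d a) (Seq (Add d d a) (Seq (Add d d a) (Add d d a)))))))"

lemma run_get_job [simp]:
  "d \<noteq> a \<Longrightarrow> run (get_job d a j) (R, M) = (R(d := job j (R a)), M)"
  by (simp add: get_job_def job_def algebra_simps)

lemma run_get_cell [simp]:
  "d \<noteq> a \<Longrightarrow> d \<noteq> 6 \<Longrightarrow> run (get_cell d a j) (R, M) = (R(d := cell (R 6) j (R a)), M)"
  by (simp add: get_cell_def cell_def fun_eq_iff)

lemma loop_free_get [simp]: "loop_free (get_job d a j)" "loop_free (get_cell d a j)"
  by (simp_all add: get_job_def get_cell_def)

fun seqs :: "com list \<Rightarrow> com" where
  "seqs [] = Skip"
| "seqs (p # ps) = Seq p (seqs ps)"

definition fetch :: com where
  "fetch = seqs [get_job 13 7 0, Load 10 13, get_job 13 7 1, Load 11 13, get_job 13 7 2, Load 12 13]"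

lemma run_fetch [simp]:
  "run fetch (R, M) =
    (R(13 := job 2 (R 7), 10 := M (job 0 (R 7)), 11 := M (job 1 (R 7)), 12 := M (job 2 (R 7))), M)"
  by (simp add: fetch_def fun_eq_iff)

lemma loop_free_fetch [simp]: "loop_free fetch"
  by (simp add: fetch_def)

definition next_job :: "nat \<Rightarrow> com" where
  "next_job a = seqs [Const 8 1, Add 7 7 8, Sub 8 a 7]"

lemma run_next_job [simp]:
  "a \<noteq> 7 \<Longrightarrow> a \<noteq> 8 \<Longrightarrow> run (next_job a) (R, M) = (R(7 := Suc (R 7), 8 := R a - Suc (R 7)), M)"
  by (simp add: next_job_def fun_eq_iff)

lemma loop_free_next_job [simp]: "loop_free (next_job a)"
  by (simp add: next_job_def)

text \<open>Register 0 is constantly 0, so \<open>Add a b 0\<close> copies a register and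
  \<open>Load 4 0\<close> reads the target at address 0.\<close>

definition init_prog :: com where
  "init_prog = seqs [Const 1 1, Const 2 2, Load 4 0, Load 5 2, Const 6 3,
     Add 6 6 5, Add 6 6 5, Add 6 6 5, Const 7 0, Add 8 5 0, Const 9 0, Const 17 0]"

text \<open>Truncated subtraction and a test for nonzero decide a strict inequality: register 16 is
  nonzero iff the job starts behind the end point in register 9.\<close>

definition greedy_body :: com where
  "greedy_body = seqs [fetch, get_cell 14 12 0, Load 15 14, Sub 16 10 9,
     If 15 Skip (If 16 (seqs [Store 14 1, Add 9 11 0, Add 17 17 1]) Skip), next_job 5]"

definition mid_prog :: com where
  "mid_prog = seqs [Sub 14 4 17, If 14 Skip (Const 4 0), Add 18 4 4, Sub 18 18 1,
     Const 7 0, Add 8 5 0, Const 20 0]"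

text \<open>Kept jobs are written over the input from the front, while the scan is still reading
  it.\<close>

definition keep_body :: com where
  "keep_body = seqs [fetch, get_cell 14 12 1, get_cell 15 12 2, Load 16 14, Load 9 15, Sub 21 10 9,
     If 21 (seqs [Add 16 16 1, Store 14 16, Store 15 11])
       (seqs [Sub 21 9 11, If 21 (Store 15 11) Skip]),
     Sub 21 16 18,
     If 21 Skip (seqs [get_job 13 20 0, Store 13 10, get_job 13 20 1, Store 13 11,
       get_job 13 20 2, Store 13 12, Add 20 20 1,
       get_cell 13 10 3, Store 13 1, get_cell 13 11 4, Store 13 1]),
     next_job 5]"

definition compress_init :: com where
  "compress_init = seqs [Const 7 0, Add 8 5 0, Const 21 0, Const 22 0]"

text \<open>The index is advanced first because coordinates begin at 1. The start mark is handled
  before the end mark, so a start never opens a new coordinate because of an end at the same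
  point.\<close>

definition compress_body :: com where
  "compress_body = seqs [next_job 5, get_cell 13 7 3, Load 10 13, get_cell 13 7 4, Load 11 13,
     If 10 (If 21 Skip (seqs [Add 22 22 1, Const 21 1])) Skip,
     get_cell 13 7 5, Store 13 22,
     If 11 (Const 21 0) Skip]"

definition remap_init :: com where
  "remap_init = seqs [Const 7 0, Add 8 20 0]"

definition remap_body :: com where
  "remap_body = seqs [fetch, get_cell 14 10 5, Load 10 14, get_job 13 7 0, Store 13 10,
     get_cell 14 11 5, Load 11 14, get_job 13 7 1, Store 13 11, next_job 20]"

definition final_prog :: com where
  "final_prog = seqs [Const 2 2, Store 0 4, Store 2 20]"

section \<open>Invariants of the four loops\<close>

context sorted_job_list
begin

lemma s_range: "v < n \<Longrightarrow> s v \<in> {1..n}"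
  using s_pos[of v] s_le_e[of v] e_le[of v] by simp

lemma e_range: "v < n \<Longrightarrow> e v \<in> {1..n}"
  using s_pos[of v] s_le_e[of v] e_le[of v] by simp

abbreviation base :: nat where "base \<equiv> 3 + 3 * n"

definition base_regs :: "nat \<Rightarrow> (nat \<Rightarrow> nat) \<Rightarrow> bool" where
  "base_regs k' R \<longleftrightarrow> R 0 = 0 \<and> R 1 = 1 \<and> R 4 = k' \<and> R 5 = n \<and> R 6 = base"

definition stored :: "(nat \<Rightarrow> nat) \<Rightarrow> nat \<Rightarrow> nat \<Rightarrow> bool" where
  "stored M i v \<longleftrightarrow> M (job 0 i) = s v \<and> M (job 1 i) = e v \<and> M (job 2 i) = c v"

definition input :: "(nat \<Rightarrow> nat) \<Rightarrow> bool" where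
  "input M \<longleftrightarrow> M 0 = k \<and> M 1 = C \<and> M 2 = n \<and> (\<forall>v<n. stored M v v) \<and> (\<forall>a\<ge>base. M a = 0)"

fun greedy_inv :: "nat \<Rightarrow> state \<Rightarrow> bool" where
  "greedy_inv i (R, M) \<longleftrightarrow> base_regs k R \<and> R 7 = i \<and> R 8 = n - i \<and>
     R 9 = snd (greedy i) \<and> R 17 = card (fst (greedy i)) \<and> M 1 = C \<and>
     (\<forall>v<n. stored M v v) \<and>
     (\<forall>x. M (cell base 0 x) = of_bool (x \<in> c ` fst (greedy i))) \<and>
     (\<forall>j x. 0 < j \<longrightarrow> j < 6 \<longrightarrow> M (cell base j x) = 0)"

lemma greedy_subset: "fst (greedy i) \<subseteq> {..<i}"
  by (induction i) (auto simp: Let_def split: prod.splits if_splits)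

lemma greedy_init:
  assumes "input M"
  shows "greedy_inv 0 (run init_prog (\<lambda>_. 0, M))"
  using assms by (auto simp: init_prog_def base_regs_def input_def cell_def)

lemma greedy_step:
  assumes "i < n" "greedy_inv i st"
  shows "fst st 8 \<noteq> 0 \<and> greedy_inv (Suc i) (run greedy_body st)"
proof -
  obtain R M where st: "st = (R, M)" by fastforce
  obtain J l where g: "greedy i = (J, l)" by fastforce
  have J: "i \<notin> J" "finite J"
    using greedy_subset[of i] g finite_subset by auto
  show ?thesis
    using assms J unfolding st
    by (auto simp: greedy_body_def base_regs_def stored_def g)
qed

fun keep_inv :: "nat \<Rightarrow> state \<Rightarrow> bool" where
  "keep_inv i (R, M) \<longleftrightarrow> base_regs new_target R \<and> R 7 = i \<and> R 8 = n - i \<and>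
     R 18 = bound \<and> R 20 = length (kept bound i) \<and> M 1 = C \<and>
     (\<forall>v<n. i \<le> v \<longrightarrow> stored M v v) \<and>
     (\<forall>j<length (kept bound i). stored M j (kept bound i ! j)) \<and>
     (\<forall>x. M (cell base 1 x) = fst (groups i x)) \<and>
     (\<forall>x. M (cell base 2 x) = snd (groups i x)) \<and>
     (\<forall>x. M (cell base 3 x) = of_bool (x \<in> s ` set (kept bound i))) \<and>
     (\<forall>x. M (cell base 4 x) = of_bool (x \<in> e ` set (kept bound i)))"

lemma keep_init:
  assumes "greedy_inv n st"
  shows "keep_inv 0 (run mid_prog st)"
proof -
  obtain R M where st: "st = (R, M)" by fastforce
  show ?thesis
    using assms unfolding st
    by (auto simp: mid_prog_def base_regs_def new_target_def bound_def kept_def)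
qed

lemma length_kept: "length (kept m i) \<le> i"
  unfolding kept_def by (metis diff_zero length_filter_le length_upt)

lemma kept_Suc: "kept m (Suc i) = (if group i \<le> m then kept m i @ [i] else kept m i)"
  by (simp add: kept_def)

lemma keep_step:
  assumes "i < n" "keep_inv i st"
  shows "fst st 8 \<noteq> 0 \<and> keep_inv (Suc i) (run keep_body st)"
proof -
  obtain R M where st: "st = (R, M)" by fastforce
  obtain g l where g: "groups i (c i) = (g, l)" by fastforce
  \<comment> \<open>The write position never overtakes the read position, so the jobs still to be
    read are intact.\<close>
  have m: "length (kept bound i) \<le> i" by (rule length_kept)
  show ?thesis
    using assms m unfolding st
    by (simp add: keep_body_def base_regs_def stored_def g kept_Suc group_def)
      (auto simp: nth_append less_Suc_eq)
qed

fun compress_inv :: "nat \<Rightarrow> state \<Rightarrow> bool" where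
  "compress_inv p (R, M) \<longleftrightarrow> base_regs new_target R \<and> R 7 = p \<and> R 8 = n - p \<and>
     R 20 = length kept_list \<and> R 21 = of_bool (snd (sweep p)) \<and> R 22 = fst (sweep p) \<and> M 1 = C \<and>
     (\<forall>j<length kept_list. stored M j (kept_list ! j)) \<and>
     (\<forall>x. M (cell base 3 x) = of_bool (x \<in> s ` set kept_list)) \<and>
     (\<forall>x. M (cell base 4 x) = of_bool (x \<in> e ` set kept_list)) \<and>
     (\<forall>x\<in>{1..p}. M (cell base 5 x) = fst (sweep x))"

lemma compress_init:
  assumes "keep_inv n st"
  shows "compress_inv 0 (run compress_init st)"
proof -
  obtain R M where st: "st = (R, M)" by fastforce
  show ?thesis
    using assms unfolding st
    by (auto simp: compress_init_def base_regs_def kept_list_def)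
qed

lemma length_kept_list: "length kept_list \<le> n"
  by (simp add: kept_list_def length_kept)

lemma compress_step:
  assumes "p < n" "compress_inv p st"
  shows "fst st 8 \<noteq> 0 \<and> compress_inv (Suc p) (run compress_body st)"
proof -
  obtain R M where st: "st = (R, M)" by fastforce
  obtain q f where g: "sweep p = (q, f)" by fastforce
  show ?thesis
    using assms length_kept_list unfolding st
    by (simp add: compress_body_def base_regs_def stored_def g Let_def)
qed

fun remap_inv :: "nat \<Rightarrow> state \<Rightarrow> bool" where
  "remap_inv i (R, M) \<longleftrightarrow> base_regs new_target R \<and> R 7 = i \<and> R 8 = length kept_list - i \<and>
     R 20 = length kept_list \<and> M 1 = C \<and>
     (\<forall>j<i. M (job 0 j) = fst (sweep (s (kept_list ! j))) \<and> M (job 1 j) = fst (sweep (e (kept_list ! j)))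
        \<and> M (job 2 j) = c (kept_list ! j)) \<and>
     (\<forall>j<length kept_list. i \<le> j \<longrightarrow> stored M j (kept_list ! j)) \<and>
     (\<forall>x\<in>{1..n}. M (cell base 5 x) = fst (sweep x))"

lemma remap_init:
  assumes "compress_inv n st"
  shows "remap_inv 0 (run remap_init st)"
proof -
  obtain R M where st: "st = (R, M)" by fastforce
  show ?thesis
    using assms unfolding st
    by (auto simp: remap_init_def base_regs_def)
qed

lemma kept_list_range:
  assumes "j < length kept_list"
  shows "kept_list ! j < n"
  using nth_mem[OF assms] by (simp add: kept_list_def kept_def)

lemma remap_step:
  assumes "i < length kept_list" "remap_inv i st"
  shows "fst st 8 \<noteq> 0 \<and> remap_inv (Suc i) (run remap_body st)"
proof -
  obtain R M where st: "st = (R, M)" by fastforce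
  show ?thesis
    using assms length_kept_list s_range[OF kept_list_range[OF assms(1)]]
      e_range[OF kept_list_range[OF assms(1)]] unfolding st
    by (auto simp: remap_body_def base_regs_def stored_def less_Suc_eq)
qed

definition kernel_output :: "state \<Rightarrow> bool" where
  "kernel_output st \<longleftrightarrow> (let M = snd st in
     M 0 = new_target \<and> M 1 = C \<and> M 2 = length kept_list \<and>
     (\<forall>j<length kept_list. M (job 0 j) = fst (sweep (s (kept_list ! j))) \<and>
        M (job 1 j) = fst (sweep (e (kept_list ! j))) \<and> M (job 2 j) = c (kept_list ! j)))"

lemma final:
  assumes "remap_inv (length kept_list) st"
  shows "kernel_output (run final_prog st)"
proof -
  obtain R M where st: "st = (R, M)" by fastforce
  have [simp]: "job i v \<noteq> 0" "job i v \<noteq> 2" for i v by (simp_all add: job_def)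
  show ?thesis
    using assms unfolding st
    by (auto simp: final_prog_def base_regs_def kernel_output_def)
qed

end

section \<open>The whole program and its running time\<close>

definition kernel_prog :: com where
  "kernel_prog = Seq init_prog (Seq (While 8 greedy_body) (Seq mid_prog (Seq (While 8 keep_body)
     (Seq compress_init (Seq (While 8 compress_body) (Seq remap_init (Seq (While 8 remap_body) final_prog)))))))"

text \<open>The parentheses follow the nesting of \<open>kernel_prog\<close>, along which
  \<open>reaches_Seq\<close> adds up the bounds. The last loop runs over the kept jobs only, of
  which there are at most \<open>m\<close>.\<close>

definition kernel_time :: "nat \<Rightarrow> nat" where
  "kernel_time m = cost init_prog + ((m * Suc (cost greedy_body) + 1) + (cost mid_prog +
     ((m * Suc (cost keep_body) + 1) + (cost compress_init + ((m * Suc (cost compress_body) + 1) +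
     (cost remap_init + ((m * Suc (cost remap_body) + 1) + cost final_prog)))))))"

lemma loop_free_parts:
  "loop_free init_prog" "loop_free greedy_body" "loop_free mid_prog" "loop_free keep_body"
  "loop_free compress_init" "loop_free compress_body" "loop_free remap_init" "loop_free remap_body"
  "loop_free final_prog"
  by (simp_all add: init_prog_def greedy_body_def mid_prog_def keep_body_def compress_init_def
      compress_body_def remap_init_def remap_body_def final_prog_def)

lemma reaches_mono: "reaches p st m Q \<Longrightarrow> m \<le> l \<Longrightarrow> reaches p st l Q"
  unfolding reaches_def by (meson order_trans)

lemma (in sorted_job_list) reaches_kernel_prog:
  assumes "input M"
  shows "reaches kernel_prog (\<lambda>_. 0, M) (kernel_time n) kernel_output"
proof -
  have start: "reaches init_prog (\<lambda>_. 0, M) (cost init_prog) (greedy_inv 0)"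
    by (intro reaches_run loop_free_parts greedy_init assms)
  have greedy: "reaches (While 8 greedy_body) st (n * Suc (cost greedy_body) + 1) (greedy_inv n)"
    if "greedy_inv 0 st" for st
    using reaches_While[where N = n and i = 0 and Inv = greedy_inv, OF greedy_step _ loop_free_parts(2) _ that]
    by fastforce
  have mid: "reaches mid_prog st (cost mid_prog) (keep_inv 0)" if "greedy_inv n st" for st
    by (intro reaches_run loop_free_parts keep_init that)
  have keep: "reaches (While 8 keep_body) st (n * Suc (cost keep_body) + 1) (keep_inv n)"
    if "keep_inv 0 st" for st
    using reaches_While[where N = n and i = 0 and Inv = keep_inv, OF keep_step _ loop_free_parts(4) _ that]
    by fastforce
  have compress0: "reaches compress_init st (cost compress_init) (compress_inv 0)" if "keep_inv n st" for st
    by (intro reaches_run loop_free_parts compress_init that)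
  have compress: "reaches (While 8 compress_body) st (n * Suc (cost compress_body) + 1) (compress_inv n)"
    if "compress_inv 0 st" for st
    using reaches_While[where N = n and i = 0 and Inv = compress_inv, OF compress_step _ loop_free_parts(6) _ that]
    by fastforce
  have remap0: "reaches remap_init st (cost remap_init) (remap_inv 0)" if "compress_inv n st" for st
    by (intro reaches_run loop_free_parts remap_init that)
  have remap: "reaches (While 8 remap_body) st (n * Suc (cost remap_body) + 1)
      (remap_inv (length kept_list))" if "remap_inv 0 st" for st
  proof (rule reaches_mono)
    show "reaches (While 8 remap_body) st (length kept_list * Suc (cost remap_body) + 1)
      (remap_inv (length kept_list))"
      using reaches_While[where N = "length kept_list" and i = 0 and Inv = remap_inv,
          OF remap_step _ loop_free_parts(8) _ that]
      by fastforce
  qed (simp add: length_kept_list del: mult_Suc_right)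
  have final: "reaches final_prog st (cost final_prog) kernel_output"
    if "remap_inv (length kept_list) st" for st
    by (intro reaches_run loop_free_parts final that)
  show ?thesis
    unfolding kernel_prog_def kernel_time_def
    apply (rule reaches_Seq[OF start])
    apply (erule reaches_Seq[OF greedy])
    apply (erule reaches_Seq[OF mid])
    apply (erule reaches_Seq[OF keep])
    apply (erule reaches_Seq[OF compress0])
    apply (erule reaches_Seq[OF compress])
    apply (erule reaches_Seq[OF remap0])
    apply (erule reaches_Seq[OF remap])
    apply (erule final)
    done
qed

section \<open>The kept intervals\<close>

context job_list
begin

definition meets :: "nat \<Rightarrow> nat \<Rightarrow> bool" where
  "meets u v \<longleftrightarrow> s u \<le> e v \<and> s v \<le> e u"

definition apart :: "nat set \<Rightarrow> bool" where
  "apart S \<longleftrightarrow> S \<subseteq> {..<n} \<and> (\<forall>u\<in>S. \<forall>v\<in>S. u \<noteq> v \<longrightarrow> \<not> meets u v)"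

definition solution :: "nat set \<Rightarrow> nat \<Rightarrow> bool" where
  "solution S m \<longleftrightarrow> apart S \<and> inj_on c S \<and> card S = m"

lemma meets_commute: "meets u v \<longleftrightarrow> meets v u"
  by (auto simp: meets_def)

lemma solution_subset: "solution S m \<Longrightarrow> T \<subseteq> S \<Longrightarrow> solution T (card T)"
  unfolding solution_def apart_def by (meson inj_on_subset subset_iff)

end

section \<open>The greedy set and the groups of each color\<close>

context sorted_job_list
begin

text \<open>Because \<open>l\<close> is the largest end point in \<open>J\<close>, comparing with
  \<open>l\<close> alone ensures disjointness. A skipped interval of a new color starts at or before
  \<open>l\<close>; the picked interval ending at \<open>l\<close> starts no later by sortedness, so
  the two meet.\<close>

lemma greedy_invariant:
  assumes "i \<le> n" "greedy i = (J, l)"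
  shows "J \<subseteq> {..<i} \<and> apart J \<and> inj_on c J \<and> (\<forall>j\<in>J. e j \<le> l) \<and> (l = 0 \<or> (\<exists>j\<in>J. e j = l)) \<and>
    (\<forall>v<i. c v \<in> c ` J \<or> (\<exists>j\<in>J. meets j v))"
  using assms
proof (induction i arbitrary: J l)
  case 0
  then show ?case by (auto simp: apart_def)
next
  case (Suc i)
  obtain J' l' where g: "greedy i = (J', l')" by fastforce
  with Suc have J': "J' \<subseteq> {..<i}" "apart J'" "inj_on c J'" "\<forall>j\<in>J'. e j \<le> l'"
      "l' = 0 \<or> (\<exists>j\<in>J'. e j = l')" "\<forall>v<i. c v \<in> c ` J' \<or> (\<exists>j\<in>J'. meets j v)"
    by auto
  have i: "i < n" using Suc.prems by simp
  show ?case
  proof (cases "c i \<notin> c ` J' \<and> l' < s i")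
    case True
    then have J: "J = insert i J'" "l = e i" using Suc.prems g by auto
    have new: "\<not> meets i j" "\<not> meets j i" if "j \<in> J'" for j
      using J'(4) True that by (auto simp: meets_def)
    have "l' \<le> e i" using True s_le_e[OF i] by simp
    moreover have "meets i i" using s_le_e[OF i] by (simp add: meets_def)
    moreover have "apart J"
      using J'(1,2) i new by (auto simp: apart_def J)
    moreover have "inj_on c J" using J'(3) True J by auto
    ultimately show ?thesis
      using J'(1,4,6) by (fastforce simp: J less_Suc_eq)
  next
    case False
    then have J: "J = J'" "l = l'" using Suc.prems g by (auto split: if_splits)
    have "c i \<in> c ` J' \<or> (\<exists>j\<in>J'. meets j i)"
    proof (cases "c i \<in> c ` J'")
      case no: False
      with False have l: "s i \<le> l'" by auto
      with s_pos[OF i] J'(5) obtain j where j: "j \<in> J'" "e j = l'" by auto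
      then have "s j \<le> s i" using J'(1) i by (intro s_mono) auto
      then have "meets j i" using j l s_le_e[OF i] by (simp add: meets_def)
      with j show ?thesis by blast
    qed simp
    with J' J show ?thesis by (auto simp: less_Suc_eq)
  qed
qed

declare groups.simps(2) [simp del]

text \<open>Here \<open>pt x g\<close> is the smallest end point in the group \<open>g\<close> of color \<open>x\<close>; the case \<open>g = 0\<close> is a dummy.\<close>

lemma groups_invariant:
  assumes "i \<le> n"
  shows "\<exists>pt. (\<forall>x. pt x 0 = 0) \<and> (\<forall>x. snd (groups i x) = pt x (fst (groups i x))) \<and>
    (\<forall>v<i. 0 < group v \<and> group v \<le> fst (groups i (c v)) \<and> s v \<le> pt (c v) (group v) \<and>
       pt (c v) (group v) \<le> e v \<and> pt (c v) (group v - 1) < s v) \<and>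
    (\<forall>x g. 0 < g \<longrightarrow> g \<le> fst (groups i x) \<longrightarrow>
       (\<exists>v<i. c v = x \<and> group v = g \<and> e v = pt x g))"
  using assms
proof (induction i)
  case 0
  show ?case by (intro exI[of _ "\<lambda>_ _. 0"]) auto
next
  case (Suc i)
  then obtain pt where pt: "\<And>x. pt x 0 = 0" "\<And>x. snd (groups i x) = pt x (fst (groups i x))"
    "\<And>v. v < i \<Longrightarrow> 0 < group v \<and> group v \<le> fst (groups i (c v)) \<and> s v \<le> pt (c v) (group v) \<and>
       pt (c v) (group v) \<le> e v \<and> pt (c v) (group v - 1) < s v"
    "\<And>x g. 0 < g \<Longrightarrow> g \<le> fst (groups i x) \<Longrightarrow> \<exists>v<i. c v = x \<and> group v = g \<and> e v = pt x g"
    by auto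
  have i: "i < n" using Suc.prems by simp
  obtain g l where gl: "groups i (c i) = (g, l)" by fastforce
  have l: "l = pt (c i) g" using pt(2)[of "c i"] gl by simp
  show ?case
  proof (cases "l < s i")
    case True
    then have Suc_i: "groups (Suc i) = (groups i)(c i := (Suc g, e i))" "group i = Suc g"
      using gl by (simp_all add: group_def groups.simps(2))
    define pt' where "pt' = pt(c i := (pt (c i))(Suc g := e i))"
    have old: "pt' x h = pt x h" if "h \<le> fst (groups i x)" for x h
      using that gl by (auto simp: pt'_def)
    show ?thesis
    proof (intro exI[of _ pt'] conjI allI impI)
      fix v assume v: "v < Suc i"
      have *: "0 < group v \<and> group v \<le> fst (groups (Suc i) (c v)) \<and> s v \<le> pt' (c v) (group v) \<and>
        pt' (c v) (group v) \<le> e v \<and> pt' (c v) (group v - 1) < s v"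
      proof (cases "v = i")
        case True
        then show ?thesis
          using Suc_i s_le_e[OF i] \<open>l < s i\<close> gl l by (simp add: pt'_def)
      next
        case False
        with v have vi: "v < i" by simp
        have "fst (groups i (c v)) \<le> fst (groups (Suc i) (c v))" using Suc_i gl by auto
        moreover have "group v - 1 \<le> fst (groups i (c v))" using pt(3)[OF vi] by auto
        ultimately show ?thesis
          using pt(3)[OF vi] old[of "group v" "c v"] old[of "group v - 1" "c v"] by simp
      qed
      then show "0 < group v" "group v \<le> fst (groups (Suc i) (c v))" "s v \<le> pt' (c v) (group v)"
        "pt' (c v) (group v) \<le> e v" "pt' (c v) (group v - 1) < s v" by auto
    next
      fix x h assume h: "0 < h" "h \<le> fst (groups (Suc i) x)"
      show "\<exists>v<Suc i. c v = x \<and> group v = h \<and> e v = pt' x h"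
      proof (cases "h \<le> fst (groups i x)")
        case True
        with pt(4)[OF h(1) this] old[OF this] show ?thesis by (metis less_SucI)
      next
        case False
        then show ?thesis
          using h Suc_i gl by (intro exI[of _ i]) (auto simp: pt'_def split: if_splits)
      qed
    qed (use pt(1,2) Suc_i in \<open>auto simp: pt'_def\<close>)
  next
    case False
    then have Suc_i: "groups (Suc i) = (groups i)(c i := (g, min l (e i)))" "group i = g"
      using gl by (simp_all add: group_def groups.simps(2))
    \<comment> \<open>The dummy group has the point 0, behind which every interval starts.\<close>
    have "g \<noteq> 0" using False s_pos[OF i] l pt(1)[of "c i"] by (intro notI) simp
    then obtain u where u: "u < i" "c u = c i" "group u = g" "e u = l"
      using pt(4)[of g "c i"] gl l by auto
    define pt' where "pt' = pt(c i := (pt (c i))(g := min l (e i)))"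
    have fst_eq: "fst (groups (Suc i) x) = fst (groups i x)" for x using Suc_i gl by simp
    have old: "pt' x h = pt x h" if "x = c i \<Longrightarrow> h \<noteq> g" for x h
      using that by (auto simp: pt'_def)
    have new: "pt' (c i) g = min l (e i)" by (simp add: pt'_def)
    show ?thesis
    proof (intro exI[of _ pt'] conjI allI impI)
      fix v assume v: "v < Suc i"
      have *: "0 < group v \<and> group v \<le> fst (groups (Suc i) (c v)) \<and> s v \<le> pt' (c v) (group v) \<and>
        pt' (c v) (group v) \<le> e v \<and> pt' (c v) (group v - 1) < s v"
      proof (cases "v = i")
        case True
        \<comment> \<open>The older member \<open>u\<close> of the group starts behind the point of
          the previous group, and \<open>i\<close> starts no earlier.\<close>
        have "pt (c i) (g - 1) < s u" using pt(3)[OF u(1)] u by simp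
        also have "s u \<le> s i" using u i by (intro s_mono) auto
        finally show ?thesis
          using True Suc_i new \<open>g \<noteq> 0\<close> False s_le_e[OF i] old[of "c i" "g - 1"] by auto
      next
        case False
        with v have vi: "v < i" by simp
        have "s v \<le> s i" using vi i by (intro s_mono) auto
        then have "s v \<le> e i" using s_le_e[OF i] by simp
        \<comment> \<open>No earlier interval of this color has a group number above
          \<open>g\<close>, so lowering the point of \<open>g\<close> concerns the members of
          \<open>g\<close> alone.\<close>
        have "group v - 1 \<noteq> g" if "c v = c i" using pt(3)[OF vi] gl that by auto
        then show ?thesis
          using pt(3)[OF vi] \<open>s v \<le> e i\<close> l new old fst_eq
          by (cases "c v = c i \<and> group v = g") auto
      qed
      then show "0 < group v" "group v \<le> fst (groups (Suc i) (c v))" "s v \<le> pt' (c v) (group v)"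
        "pt' (c v) (group v) \<le> e v" "pt' (c v) (group v - 1) < s v" by auto
    next
      fix x h assume h: "0 < h" "h \<le> fst (groups (Suc i) x)"
      show "\<exists>v<Suc i. c v = x \<and> group v = h \<and> e v = pt' x h"
      proof (cases "x = c i \<and> h = g")
        case True
        then show ?thesis
          using u Suc_i new by (cases "l \<le> e i") (auto intro: exI[of _ u] exI[of _ i] simp: min_def)
      next
        case False
        with h fst_eq pt(4)[of h x] old[of x h] show ?thesis by (metis less_SucI)
      qed
    qed (use pt(1,2) Suc_i \<open>g \<noteq> 0\<close> in \<open>auto simp: pt'_def\<close>)
  qed
qed

text \<open>Since \<open>pt (c v) (group v)\<close> lies in every interval of its group, groups are
  cliques. The function \<open>f\<close> selects representatives; each starts behind the point at
  which the previous one ends.\<close>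

lemma groups_points:
  obtains pt where
    "\<And>v. v < n \<Longrightarrow> 0 < group v \<and> s v \<le> pt (c v) (group v) \<and> pt (c v) (group v) \<le> e v"
    "\<And>v m. v < n \<Longrightarrow> m \<le> group v \<Longrightarrow> \<exists>f. \<forall>g\<in>{1..m}. f g < n \<and> c (f g) = c v \<and> group (f g) = g \<and>
       pt (c v) (g - 1) < s (f g) \<and> e (f g) = pt (c v) g"
proof -
  obtain pt where pt: "\<And>v. v < n \<Longrightarrow> 0 < group v \<and> group v \<le> fst (groups n (c v)) \<and>
       s v \<le> pt (c v) (group v) \<and> pt (c v) (group v) \<le> e v \<and> pt (c v) (group v - 1) < s v"
    "\<And>x g. 0 < g \<Longrightarrow> g \<le> fst (groups n x) \<Longrightarrow> \<exists>v<n. c v = x \<and> group v = g \<and> e v = pt x g"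
    using groups_invariant[OF order_refl] by blast
  show thesis
  proof
    fix v m assume v: "v < n" "m \<le> group v"
    have "\<exists>w. w < n \<and> c w = c v \<and> group w = g \<and> pt (c v) (g - 1) < s w \<and> e w = pt (c v) g"
      if "g \<in> {1..m}" for g
    proof -
      have "g \<le> fst (groups n (c v))" "0 < g" using pt(1)[OF v(1)] v that by auto
      then obtain w where "w < n" "c w = c v" "group w = g" "e w = pt (c v) g" using pt(2) by blast
      with pt(1)[OF this(1)] show ?thesis by auto
    qed
    then show "\<exists>f. \<forall>g\<in>{1..m}. f g < n \<and> c (f g) = c v \<and> group (f g) = g \<and>
       pt (c v) (g - 1) < s (f g) \<and> e (f g) = pt (c v) g" by (intro bchoice) blast
  qed (use pt(1) in blast)
qed

lemma group_pos: "v < n \<Longrightarrow> 0 < group v"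
  using groups_points by metis

text \<open>Consecutive representatives are disjoint, and the points increase with the group number,
  which carries disjointness over to all pairs.\<close>

lemma group_representatives:
  assumes "v < n" "m \<le> group v"
  shows "\<exists>Q \<subseteq> {u. u < n \<and> c u = c v \<and> group u \<le> m}. apart Q \<and> card Q = m"
proof -
  obtain pt where "\<And>v m. v < n \<Longrightarrow> m \<le> group v \<Longrightarrow> \<exists>f. \<forall>g\<in>{1..m}. f g < n \<and> c (f g) = c v \<and>
       group (f g) = g \<and> pt (c v) (g - 1) < s (f g) \<and> e (f g) = pt (c v) g"
    by (rule groups_points) blast
  from this[OF assms] obtain f where f: "\<And>g. g \<in> {1..m} \<Longrightarrow> f g < n \<and> c (f g) = c v \<and>
       group (f g) = g \<and> pt (c v) (g - 1) < s (f g) \<and> e (f g) = pt (c v) g"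
    by blast
  have mono: "pt (c v) g \<le> pt (c v) h" if "g \<le> h" "h \<le> m" for g h
    using that
  proof (induction rule: dec_induct)
    case (step h)
    then have "pt (c v) h < s (f (Suc h))" "e (f (Suc h)) = pt (c v) (Suc h)" "f (Suc h) < n"
      using f[of "Suc h"] by auto
    with step s_le_e[of "f (Suc h)"] show ?case by simp
  qed simp
  have "e (f g) < s (f h)" if "g < h" "1 \<le> g" "h \<le> m" for g h
  proof -
    have "pt (c v) g \<le> pt (c v) (h - 1)" using mono[of g "h - 1"] that by simp
    with f[of g] f[of h] that show ?thesis by simp
  qed
  then have less: "\<not> meets (f g) (f h)" "\<not> meets (f h) (f g)" if "g < h" "1 \<le> g" "h \<le> m" for g h
    using that unfolding meets_def by (meson linorder_not_less)+
  have "apart (f ` {1..m})"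
    unfolding apart_def
  proof (intro conjI ballI impI)
    fix a b assume "a \<in> f ` {1..m}" "b \<in> f ` {1..m}" "a \<noteq> b"
    then obtain g h where "a = f g" "b = f h" "g \<in> {1..m}" "h \<in> {1..m}" "g \<noteq> h" by blast
    then show "\<not> meets a b" using less by (cases "g < h") auto
  qed (use f in auto)
  moreover have "inj_on f {1..m}" using f by (intro inj_on_inverseI[of _ group]) blast
  then have "card (f ` {1..m}) = m" by (simp add: card_image)
  ultimately show ?thesis
    using f by (intro exI[of _ "f ` {1..m}"]) auto
qed

end

text \<open>A minimum representation need not be proper: on a path with three vertices it consists
  of \<open>[1,1]\<close>, \<open>[1,2]\<close> and \<open>[2,2]\<close>. Hence \<open>l\<close> and
  \<open>r\<close> give a second, proper representation of the same graph, which only the analysis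
  refers to.\<close>

locale proper_job_list = sorted_job_list +
  fixes \<omega> :: nat and l r :: "nat \<Rightarrow> real"
  assumes clique_le: "K \<subseteq> {..<n} \<Longrightarrow> (\<And>u v. u \<in> K \<Longrightarrow> v \<in> K \<Longrightarrow> meets u v) \<Longrightarrow> card K \<le> \<omega>"
    and meets_real: "u < n \<Longrightarrow> v < n \<Longrightarrow> meets u v \<longleftrightarrow> l u \<le> r v \<and> l v \<le> r u"
    and l_le_r: "v < n \<Longrightarrow> l v \<le> r v"
    and not_nested: "u < n \<Longrightarrow> v < n \<Longrightarrow> \<not> {l u..r u} \<subset> {l v..r v}"
begin

lemma proper: "u < n \<Longrightarrow> v < n \<Longrightarrow> l v < l u \<Longrightarrow> r v \<le> r u"
  using not_nested[of u v] l_le_r[of v] by (auto simp: psubset_eq)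

text \<open>In a proper representation, every interval that meets \<open>j\<close> contains an endpoint of \<open>j\<close>.\<close>

lemma neighbours_cliques:
  assumes "j < n"
  obtains A B where "{v. v < n \<and> meets j v} = A \<union> B"
    "\<And>u v. u \<in> A \<Longrightarrow> v \<in> A \<Longrightarrow> meets u v" "\<And>u v. u \<in> B \<Longrightarrow> v \<in> B \<Longrightarrow> meets u v"
proof
  \<comment> \<open>All intervals in \<open>?A\<close> contain \<open>l j\<close>; all those in
    \<open>?B\<close> contain \<open>r j\<close>, by \<open>proper\<close>.\<close>
  let ?A = "{v. v < n \<and> meets j v \<and> l v \<le> l j}" and ?B = "{v. v < n \<and> meets j v \<and> l j < l v}"
  show "{v. v < n \<and> meets j v} = ?A \<union> ?B" by auto
  show "meets u v" if "u \<in> ?A" "v \<in> ?A" for u v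
    using that meets_real[of u v] meets_real[of j u] meets_real[of j v] assms by auto
  show "meets u v" if "u \<in> ?B" "v \<in> ?B" for u v
    using that meets_real[of u v] meets_real[of j u] meets_real[of j v] assms
      proper[of u j] proper[of v j] by auto
qed

lemma neighbours_le:
  assumes "j < n"
  shows "card {v. v < n \<and> meets j v} \<le> 2 * \<omega>"
proof -
  obtain A B where AB: "{v. v < n \<and> meets j v} = A \<union> B"
    "\<And>u v. u \<in> A \<Longrightarrow> v \<in> A \<Longrightarrow> meets u v" "\<And>u v. u \<in> B \<Longrightarrow> v \<in> B \<Longrightarrow> meets u v"
    using neighbours_cliques[OF assms] by metis
  then have "A \<subseteq> {..<n}" "B \<subseteq> {..<n}" by auto
  then have "card A \<le> \<omega>" "card B \<le> \<omega>" using AB clique_le by auto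
  then show ?thesis using AB(1) card_Un_le[of A B] by simp
qed

text \<open>Pairwise disjoint intervals share at most one element with each of the two cliques
  covering the neighbourhood. This is the absence of induced claws.\<close>

lemma apart_neighbours_le:
  assumes "j < n" "apart Q"
  shows "card {v \<in> Q. meets j v} \<le> 2"
proof -
  obtain A B where AB: "{v. v < n \<and> meets j v} = A \<union> B"
    "\<And>u v. u \<in> A \<Longrightarrow> v \<in> A \<Longrightarrow> meets u v" "\<And>u v. u \<in> B \<Longrightarrow> v \<in> B \<Longrightarrow> meets u v"
    using neighbours_cliques[OF assms(1)] by metis
  have Q: "Q \<subseteq> {..<n}" "\<And>u v. u \<in> Q \<Longrightarrow> v \<in> Q \<Longrightarrow> meets u v \<Longrightarrow> u = v"
    using assms(2) by (auto simp: apart_def)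
  then have "finite Q" using finite_subset by blast
  then have "card (Q \<inter> A) \<le> 1" "card (Q \<inter> B) \<le> 1"
    using AB(2,3) Q(2) by (auto simp: card_le_Suc0_iff_eq)
  moreover have "{v \<in> Q. meets j v} = (Q \<inter> A) \<union> (Q \<inter> B)" using AB(1) Q(1) by auto
  ultimately show ?thesis using card_Un_le[of "Q \<inter> A" "Q \<inter> B"] by simp
qed

lemma color_class_le: "card {v. v < n \<and> c v = x \<and> group v \<le> m} \<le> m * \<omega>"
proof -
  obtain pt where pt: "\<And>v. v < n \<Longrightarrow> s v \<le> pt (c v) (group v) \<and> pt (c v) (group v) \<le> e v"
    by (rule groups_points) blast
  let ?V = "\<lambda>g. {v. v < n \<and> c v = x \<and> group v = g}"
  have "card (?V g) \<le> \<omega>" for g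
  proof (rule clique_le)
    fix u v assume "u \<in> ?V g" "v \<in> ?V g"
    then show "meets u v" using pt[of u] pt[of v] by (auto simp: meets_def)
  qed auto
  then have "(\<Sum>g\<in>{1..m}. card (?V g)) \<le> m * \<omega>"
    using sum_bounded_above[of "{1..m}" "\<lambda>g. card (?V g)" \<omega>] by simp
  moreover have "{v. v < n \<and> c v = x \<and> group v \<le> m} = (\<Union>g\<in>{1..m}. ?V g)"
    using group_pos by (auto simp: Suc_le_eq)
  ultimately show ?thesis using card_UN_le[of "{1..m}" ?V] by simp
qed

text \<open>Induction on the number of members in late groups. Such a member \<open>v\<close> is
  replaced by a representative \<open>q\<close> of its own color, so colors stay distinct; every
  other member blocks at most two representatives.\<close>

lemma solution_exchange:
  assumes "solution S k" "0 < k"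
  shows "\<exists>T. solution T k \<and> (\<forall>v\<in>T. group v \<le> 2 * k - 1)"
  using assms(1)
proof (induction "card {v \<in> S. 2 * k - 1 < group v}" arbitrary: S rule: less_induct)
  case less
  have S: "S \<subseteq> {..<n}" "inj_on c S" "card S = k" "apart S"
    using less.prems by (auto simp: solution_def apart_def)
  have fin: "finite S" using finite_subset[OF S(1)] by simp
  show ?case
  proof (cases "\<forall>v\<in>S. group v \<le> 2 * k - 1")
    case True
    with less.prems show ?thesis by blast
  next
    case False
    then obtain v where v: "v \<in> S" "2 * k - 1 < group v" by (auto simp: not_le)
    then obtain Q where Q: "Q \<subseteq> {u. u < n \<and> c u = c v \<and> group u \<le> 2 * k - 1}" "apart Q"
        "card Q = 2 * k - 1"
      using group_representatives[of v "2 * k - 1"] S(1) by auto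
    let ?U = "S - {v}"
    let ?bad = "\<Union>u\<in>?U. {q \<in> Q. meets u q}"
    have "card ?bad \<le> (\<Sum>u\<in>?U. card {q \<in> Q. meets u q})" using fin by (intro card_UN_le) auto
    also have "\<dots> \<le> card ?U * 2"
    proof -
      have "card {q \<in> Q. meets u q} \<le> 2" if "u \<in> ?U" for u
        using that S(1) by (intro apart_neighbours_le Q(2)) auto
      then show ?thesis using sum_bounded_above[of ?U "\<lambda>u. card {q \<in> Q. meets u q}" 2] by simp
    qed
    \<comment> \<open>The \<open>k - 1\<close> other members block at most \<open>2 * k - 2\<close>
      of the \<open>2 * k - 1\<close> representatives.\<close>
    also have "\<dots> < card Q" using v fin S(3) Q(3) assms(2) by simp
    finally have "card ?bad < card Q" .
    then have "?bad \<noteq> Q" by auto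
    then have "\<not> Q \<subseteq> ?bad" by blast
    then obtain q where q: "q \<in> Q" "\<And>u. u \<in> ?U \<Longrightarrow> \<not> meets u q" by blast
    have qn: "q < n" "c q = c v" "group q \<le> 2 * k - 1" using q Q(1) by auto
    \<comment> \<open>If \<open>q\<close> were among the other members, it would block
      itself.\<close>
    then have "meets q q" using s_le_e by (simp add: meets_def)
    then have "q \<notin> ?U" using q by blast
    have "\<not> meets q u" if "u \<in> ?U" for u using q(2)[OF that] by (subst meets_commute)
    then have apart: "apart (insert q ?U)"
      using S(4) q(2) qn by (auto simp: apart_def)
    have inj: "inj_on c (insert q ?U)"
      using S(2) v qn \<open>q \<notin> ?U\<close> by (auto simp: inj_on_def)
    have "solution (insert q ?U) k"
      using apart inj S(3) fin v \<open>q \<notin> ?U\<close> assms(2) by (simp add: solution_def)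
    moreover have "{w \<in> insert q ?U. 2 * k - 1 < group w} \<subset> {w \<in> S. 2 * k - 1 < group w}"
      using v qn by auto
    then have "card {w \<in> insert q ?U. 2 * k - 1 < group w} < card {w \<in> S. 2 * k - 1 < group w}"
      using fin by (intro psubset_card_mono) auto
    ultimately show ?thesis using less.hyps by blast
  qed
qed

lemma greedy_solution:
  assumes "greedy n = (J, x)"
  shows "solution J (card J)"
  using greedy_invariant[OF order_refl assms] by (simp add: solution_def)

text \<open>By maximality of \<open>J\<close>, each kept interval is charged to an element of
  \<open>J\<close> that shares its color or meets it.\<close>

lemma kept_le:
  assumes "greedy n = (J, x)" "card J < k"
  shows "card {v. v < n \<and> group v \<le> 2 * k - 1} \<le> 4 * k\<^sup>2 * \<omega>"
proof -
  have J: "J \<subseteq> {..<n}" "\<And>v. v < n \<Longrightarrow> c v \<in> c ` J \<or> (\<exists>j\<in>J. meets j v)"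
    using greedy_invariant[OF order_refl assms(1)] by auto
  then have "finite J" using finite_subset by blast
  let ?C = "\<lambda>j. {v. v < n \<and> c v = c j \<and> group v \<le> 2 * k - 1}"
  let ?N = "\<lambda>j. {v. v < n \<and> meets j v}"
  have "card (?C j \<union> ?N j) \<le> (2 * k - 1) * \<omega> + 2 * \<omega>" if "j \<in> J" for j
    using card_Un_le[of "?C j" "?N j"] color_class_le[of "c j" "2 * k - 1"] neighbours_le[of j] J(1) that
    by auto
  then have sum: "(\<Sum>j\<in>J. card (?C j \<union> ?N j)) \<le> card J * ((2 * k - 1) * \<omega> + 2 * \<omega>)"
    using sum_bounded_above[of J "\<lambda>j. card (?C j \<union> ?N j)"] by simp
  have sub: "{v. v < n \<and> group v \<le> 2 * k - 1} \<subseteq> (\<Union>j\<in>J. ?C j \<union> ?N j)"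
    using J(2) by blast
  have "card {v. v < n \<and> group v \<le> 2 * k - 1} \<le> card (\<Union>j\<in>J. ?C j \<union> ?N j)"
    by (rule card_mono[OF finite_subset[of _ "{..<n}"] sub]) auto
  also have "\<dots> \<le> card J * ((2 * k - 1) * \<omega> + 2 * \<omega>)"
    by (rule order_trans[OF card_UN_le[OF \<open>finite J\<close>] sum])
  also have "\<dots> \<le> k * (4 * k * \<omega>)"
  proof (rule mult_mono)
    \<comment> \<open>Here \<open>card J < k\<close> provides \<open>1 \<le> k\<close>.\<close>
    have "2 * k - 1 + 2 \<le> 4 * k" using assms(2) by simp
    then have "(2 * k - 1 + 2) * \<omega> \<le> 4 * k * \<omega>" by (rule mult_le_mono1)
    then show "(2 * k - 1) * \<omega> + 2 * \<omega> \<le> 4 * k * \<omega>" by (simp only: distrib_right)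
  qed (use assms in auto)
  finally show ?thesis by (simp add: power2_eq_square ac_simps)
qed

lemma set_kept_list: "set kept_list = {v. v < n \<and> group v \<le> bound}"
  by (auto simp: kept_list_def kept_def)

lemma kept_list_le: "card (set kept_list) \<le> 4 * k\<^sup>2 * \<omega>"
proof (cases "new_target = 0")
  case True
  then have "set kept_list = {}" using group_pos by (auto simp: set_kept_list bound_def)
  then show ?thesis by simp
next
  case False
  then show ?thesis
    using kept_le[of "fst (greedy n)" "snd (greedy n)"]
    by (simp add: set_kept_list bound_def new_target_def split: if_splits)
qed

text \<open>For \<open>new_target = 0\<close> both sides are true: \<open>k\<close> elements of the
  greedy set witness the left one, the empty set the right one. Otherwise the exchange argument
  applies.\<close>

lemma solution_iff:
  "(\<exists>S. solution S k) \<longleftrightarrow> (\<exists>S. solution S new_target \<and> S \<subseteq> set kept_list)"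
proof (cases "new_target = 0")
  case True
  obtain T where "T \<subseteq> fst (greedy n)" "card T = k"
    using True obtain_subset_with_card_n[of k "fst (greedy n)"]
    by (auto simp: new_target_def split: if_splits)
  then have "solution T k"
    using solution_subset[OF greedy_solution[of "fst (greedy n)" "snd (greedy n)"]] by auto
  moreover have "solution {} new_target" using True by (simp add: solution_def apart_def)
  ultimately show ?thesis by blast
next
  case False
  then have eq: "new_target = k" "0 < k" by (auto simp: new_target_def split: if_splits)
  show ?thesis
  proof
    assume "\<exists>S. solution S k"
    then obtain T where T: "solution T k" "\<forall>v\<in>T. group v \<le> 2 * k - 1"
      using solution_exchange eq by blast
    then have "T \<subseteq> {..<n}" by (simp add: solution_def apart_def)
    with T eq show "\<exists>S. solution S new_target \<and> S \<subseteq> set kept_list"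
      by (auto simp: set_kept_list bound_def intro!: exI[of _ T])
  qed (use eq in auto)
qed

end

section \<open>Minimum representations\<close>

lemma compress_mono: "p \<le> q \<Longrightarrow> fst (compress S E p) \<le> fst (compress S E q)"
proof (induction rule: dec_induct)
  case (step q)
  then show ?case by (auto simp: Let_def split: prod.splits)
qed simp

lemma compress_open_pos: "snd (compress S E p) \<Longrightarrow> 0 < fst (compress S E p)"
  by (induction p) (auto simp: Let_def split: prod.splits if_splits)

lemma compress_start_pos:
  assumes "p \<in> S" "0 < p"
  shows "0 < fst (compress S E p)"
proof -
  obtain q where p: "p = Suc q" using assms(2) gr0_implies_Suc by blast
  show ?thesis
    using assms(1) compress_open_pos[of S E q] by (auto simp: p Let_def split: prod.splits)
qed

text \<open>The end point \<open>a\<close> closes the current coordinate. By \<open>after\<close>,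
  it stays closed until the counter grows, and the start point \<open>b\<close> forces growth at the
  latest.\<close>

lemma compress_strict:
  assumes "a \<in> E" "0 < a" "a < b" "b \<in> S"
  shows "fst (compress S E a) < fst (compress S E b)"
proof -
  have after: "fst (compress S E a) < fst (compress S E p) \<or> \<not> snd (compress S E p)" if "a \<le> p" for p
    using that
  proof (induction rule: dec_induct)
    case base
    obtain q where "a = Suc q" using assms(2) gr0_implies_Suc by blast
    with assms(1) show ?case by (auto simp: Let_def split: prod.splits)
  next
    case (step p)
    then show ?case
      using compress_mono[of a p S E] by (auto simp: Let_def split: prod.splits)
  qed
  obtain p where p: "b = Suc p" using assms(3) by (cases b) auto
  then have "a \<le> p" using assms(3) by simp
  from after[OF this] compress_mono[OF this, of S E] show ?thesis
    using assms(4) by (auto simp: p Let_def split: prod.splits)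
qed

text \<open>The counter grows by single steps, and only at start points.\<close>

lemma compress_hits_start:
  assumes "0 < q" "q \<le> fst (compress S E p)"
  shows "\<exists>a\<in>S. a \<le> p \<and> fst (compress S E a) = q"
  using assms(2)
proof (induction p)
  case (Suc p)
  show ?case
  proof (cases "q \<le> fst (compress S E p)")
    case True
    with Suc.IH show ?thesis using le_SucI by blast
  next
    case False
    with Suc.prems have "Suc p \<in> S" "q = fst (compress S E (Suc p))"
      by (auto simp: Let_def split: prod.splits if_splits)
    then show ?thesis by blast
  qed
qed (use assms(1) in simp)

text \<open>The counter advances only from a closed coordinate, and only end points close one. A
  coordinate still open at \<open>p\<close> has to be excepted.\<close>

lemma compress_hits_end:
  assumes "0 < q" "q < fst (compress S E p) \<or> (q = fst (compress S E p) \<and> \<not> snd (compress S E p))"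
  shows "\<exists>a\<in>E. a \<le> p \<and> fst (compress S E a) = q"
  using assms(2)
proof (induction p)
  case (Suc p)
  show ?case
  proof (cases "q < fst (compress S E p) \<or> (q = fst (compress S E p) \<and> \<not> snd (compress S E p))")
    case True
    with Suc.IH show ?thesis using le_SucI by blast
  next
    case False
    with Suc.prems have "Suc p \<in> E" "q = fst (compress S E (Suc p))"
      by (auto simp: Let_def split: prod.splits if_splits)
    then show ?thesis by blast
  qed
qed (use assms(1) in simp)

lemma verts_intersection_graph [simp]: "verts (intersection_graph V l r) = V"
  by (simp add: verts_def intersection_graph_def)

lemma adj_intersection_graph:
  "adj (intersection_graph V l r) u v \<longleftrightarrow>
    u \<in> V \<and> v \<in> V \<and> u \<noteq> v \<and> {l u..r u} \<inter> {l v..r v} \<noteq> {}"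
  unfolding adj_def intersection_graph_def by (auto simp: doubleton_eq_iff Int_commute)

lemma intervals_meet_iff:
  fixes l r :: "'v \<Rightarrow> 'a::linorder"
  assumes "l u \<le> r u" "l v \<le> r v"
  shows "{l u..r u} \<inter> {l v..r v} \<noteq> {} \<longleftrightarrow> l u \<le> r v \<and> l v \<le> r u"
  using assms by (auto simp: Int_atLeastAtMost)

lemma intersection_graph_cong:
  assumes "\<And>u v. u \<in> V \<Longrightarrow> v \<in> V \<Longrightarrow> u \<noteq> v \<Longrightarrow>
    {l u..r u} \<inter> {l v..r v} \<noteq> {} \<longleftrightarrow> {l' u..r' u} \<inter> {l' v..r' v} \<noteq> {}"
  shows "intersection_graph V l r = intersection_graph V l' r'"
proof -
  have "(u \<in> V \<and> v \<in> V \<and> u \<noteq> v \<and> {l u..r u} \<inter> {l v..r v} \<noteq> {}) \<longleftrightarrow>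
      (u \<in> V \<and> v \<in> V \<and> u \<noteq> v \<and> {l' u..r' u} \<inter> {l' v..r' v} \<noteq> {})" for u v
    using assms[of u v] by metis
  then show ?thesis by (simp only: intersection_graph_def)
qed

lemma representation_adj:
  assumes "interval_representation G l r" "u \<in> verts G" "v \<in> verts G" "u \<noteq> v"
  shows "adj G u v \<longleftrightarrow> l u \<le> r v \<and> l v \<le> r u"
proof -
  have "l u \<le> r u" "l v \<le> r v" and G: "G = intersection_graph (verts G) l r"
    using assms unfolding interval_representation_def by auto
  then show ?thesis
    using assms(2-) adj_intersection_graph[of "verts G" l r u v] intervals_meet_iff[of l u r v] by simp
qed

lemma finite_cliques: "finite (verts G) \<Longrightarrow> finite {K. clique G K}"
  by (rule finite_subset[of _ "Pow (verts G)"]) (auto simp: clique_def)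

lemma clique_le_clique_number:
  assumes "finite (verts G)" "clique G K"
  shows "card K \<le> clique_number G"
  unfolding clique_number_def using assms finite_cliques[OF assms(1)] by (intro Max_ge) auto

lemma clique_number_le:
  assumes "finite (verts G)" "\<And>K. clique G K \<Longrightarrow> card K \<le> m"
  shows "clique_number G \<le> m"
proof -
  have "clique G {}" by (simp add: clique_def)
  then show ?thesis
    unfolding clique_number_def using assms finite_cliques[OF assms(1)] by (subst Max_le_iff) auto
qed

text \<open>For every point \<open>q\<close>, the intervals containing \<open>q\<close> have a common point \<open>p q\<close> in any other
  representation. The map \<open>p\<close> is injective: if \<open>p q = p q'\<close> with \<open>q < q'\<close>, then an interval that
  ends at \<open>q\<close> meets one that starts at \<open>q'\<close>.\<close>

lemma minimum_representationI:
  assumes fin: "finite (verts G)" and rep: "representation_upto G m l r"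
    and starts: "\<And>q. q \<in> {1..m} \<Longrightarrow> \<exists>v\<in>verts G. l v = q"
    and ends: "\<And>q. q \<in> {1..m} \<Longrightarrow> \<exists>v\<in>verts G. r v = q"
  shows "minimum_representation G l r"
  unfolding minimum_representation_def
proof (intro exI[of _ m] conjI allI impI rep)
  fix m' l' r' assume "representation_upto G m' l' r'"
  then have rep': "interval_representation G l' r'"
      "\<And>v. v \<in> verts G \<Longrightarrow> l' v \<in> {1..m'} \<and> r' v \<in> {1..m'}"
    by (auto simp: representation_upto_def)
  have rep1: "interval_representation G l r" using rep by (simp add: representation_upto_def)
  have le: "l v \<le> r v" "l' v \<le> r' v" if "v \<in> verts G" for v
    using that rep1 rep'(1) by (auto simp: interval_representation_def)
  define C where "C q = {v \<in> verts G. l v \<le> q \<and> q \<le> r v}" for q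
  \<comment> \<open>The largest start point among pairwise meeting intervals lies in all of
    them.\<close>
  define p where "p q = Max (l' ` C q)" for q
  have C: "finite (C q)" for q using fin by (simp add: C_def)
  have p: "l' v \<le> p q \<and> p q \<le> r' v" if "v \<in> C q" for v q
  proof -
    have "p q \<in> l' ` C q" using that C unfolding p_def by (intro Max_in) auto
    then obtain u where u: "u \<in> C q" "p q = l' u" by auto
    have "l' u \<le> r' v"
    proof (cases "u = v")
      case False
      have "l u \<le> r v \<and> l v \<le> r u" using u that by (auto simp: C_def)
      then show ?thesis
        using representation_adj[OF rep1 _ _ False] representation_adj[OF rep'(1) _ _ False] u that
        by (auto simp: C_def)
    qed (use le u in \<open>auto simp: C_def\<close>)
    moreover have "l' v \<le> p q" using that C unfolding p_def by (intro Max_ge) auto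
    ultimately show ?thesis using u by simp
  qed
  have less: "p q \<noteq> p q'" if qs: "q < q'" "q \<in> {1..m}" "q' \<in> {1..m}" for q q'
  proof
    assume eq: "p q = p q'"
    obtain u where u: "u \<in> verts G" "r u = q" using ends[OF qs(2)] by blast
    obtain v where v: "v \<in> verts G" "l v = q'" using starts[OF qs(3)] by blast
    have "u \<in> C q" "v \<in> C q'" using u v le by (auto simp: C_def)
    from p[OF this(1)] p[OF this(2)] eq have "l' u \<le> r' v \<and> l' v \<le> r' u" by linarith
    moreover have "u \<noteq> v" using u v le[of v] qs by auto
    ultimately have "l v \<le> r u"
      using representation_adj[OF rep1 u(1) v(1)] representation_adj[OF rep'(1) u(1) v(1)] by simp
    with u v qs show False by simp
  qed
  have "inj_on p {1..m}"
    by (rule inj_onI) (metis less linorder_neqE_nat)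
  moreover have "p ` {1..m} \<subseteq> {1..m'}"
  proof (rule image_subsetI)
    fix q assume "q \<in> {1..m}"
    from starts[OF this] obtain v where "v \<in> verts G" "l v = q" by blast
    then have "v \<in> C q" using le by (auto simp: C_def)
    from p[OF this] rep'(2)[OF \<open>v \<in> verts G\<close>] show "p q \<in> {1..m'}" by auto
  qed
  ultimately show "m \<le> m'" using card_inj_on_le[of p "{1..m}" "{1..m'}"] by simp
qed

text \<open>A point at which no interval starts can be merged with its predecessor.\<close>

lemma minimum_representation_end_le:
  assumes fin: "finite (verts G)" and min: "minimum_representation G l r" and v: "v \<in> verts G"
  shows "r v \<le> card (verts G)"
proof -
  obtain m where rep: "representation_upto G m l r"
    and least: "\<And>m' l' r'. representation_upto G m' l' r' \<Longrightarrow> m \<le> m'"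
    using min unfolding minimum_representation_def by blast
  have rep': "\<And>u. u \<in> verts G \<Longrightarrow> l u \<le> r u" "G = intersection_graph (verts G) l r"
    "\<And>u. u \<in> verts G \<Longrightarrow> l u \<in> {1..m} \<and> r u \<in> {1..m}"
    using rep by (auto simp: representation_upto_def interval_representation_def)
  have "{1..m} \<subseteq> l ` verts G"
  proof
    fix q assume q: "q \<in> {1..m}"
    show "q \<in> l ` verts G"
    proof (rule ccontr)
      assume no: "q \<notin> l ` verts G"
      \<comment> \<open>Only \<open>q - 1\<close> and \<open>q\<close> are identified. The order
        between a start and an end could change only for a start at \<open>q\<close>.\<close>
      define f where "f x = (if q \<le> x then x - 1 else x)" for x :: nat
      have "f (l u) \<le> f (r w) \<longleftrightarrow> l u \<le> r w" if "u \<in> verts G" "w \<in> verts G" for u w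
      proof -
        have "l u \<noteq> q" using no that by blast
        then show ?thesis using q by (auto simp: f_def)
      qed
      note f = this
      have range: "f (l u) \<in> {1..m - 1} \<and> f (r u) \<in> {1..m - 1}" if "u \<in> verts G" for u
      proof -
        have "l u \<noteq> q" using no that by blast
        then show ?thesis using q rep'(1,3)[OF that] by (auto simp: f_def)
      qed
      have "intersection_graph (verts G) l r =
          intersection_graph (verts G) (\<lambda>u. f (l u)) (\<lambda>u. f (r u))"
        using rep'(1) f by (intro intersection_graph_cong) (simp add: intervals_meet_iff)
      then have "interval_representation G (\<lambda>u. f (l u)) (\<lambda>u. f (r u))"
        unfolding interval_representation_def using rep'(1,2) f by simp
      then have "representation_upto G (m - 1) (\<lambda>u. f (l u)) (\<lambda>u. f (r u))"
        unfolding representation_upto_def using range by blast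
      from least[OF this] q show False by simp
    qed
  qed
  then have "card {1..m} \<le> card (l ` verts G)" using fin by (intro card_mono) auto
  also have "\<dots> \<le> card (verts G)" using fin by (rule card_image_le)
  finally show ?thesis using rep'(3)[OF v] by simp
qed

section \<open>The reduced instance and its encoding\<close>

context job_list
begin

abbreviation nm :: "nat \<Rightarrow> nat" where
  "nm p \<equiv> fst (sweep p)"

definition reduced :: jis where
  "reduced = \<lparr>jobs = map (\<lambda>v. (nm (s v), nm (e v), c v)) kept_list,
     num_colors = C, target = new_target\<rparr>"

lemma reduced_simps [simp]:
  "num_jobs reduced = length kept_list" "num_colors reduced = C" "target reduced = new_target"
  "j < length kept_list \<Longrightarrow> start_of reduced j = nm (s (kept_list ! j))"
  "j < length kept_list \<Longrightarrow> end_of reduced j = nm (e (kept_list ! j))"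
  "j < length kept_list \<Longrightarrow> color_of reduced j = c (kept_list ! j)"
  by (simp_all add: reduced_def num_jobs_def start_of_def end_of_def color_of_def)

end

lemma length_encode: "length (encode x) = 3 + 3 * num_jobs x"
proof -
  have "length (concat (map (\<lambda>(s, e, c). [s, e, c]) js)) = 3 * length js"
    for js :: "(nat \<times> nat \<times> nat) list"
    by (induction js) auto
  then show ?thesis by (simp add: encode_def num_jobs_def)
qed

lemma nth_encode_job:
  assumes "v < num_jobs x" "j < 3"
  shows "encode x ! job j v = [start_of x v, end_of x v, color_of x v] ! j"
proof -
  have "concat (map (\<lambda>(s, e, c). [s, e, c]) js) ! (3 * v + j) =
      [fst (js ! v), fst (snd (js ! v)), snd (snd (js ! v))] ! j"
    if "v < length js" for v and js :: "(nat \<times> nat \<times> nat) list"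
    using that
  proof (induction js arbitrary: v)
    case (Cons a js)
    then show ?case using \<open>j < 3\<close> by (cases v; cases a) (auto simp: nth_append nth_Cons' numeral_3_eq_3 less_Suc_eq)
  qed simp
  from this[of v "jobs x"] assms(1) show ?thesis
    by (simp add: encode_def job_def num_jobs_def start_of_def end_of_def color_of_def
        numeral_3_eq_3)
qed

lemma encode_agrees:
  assumes "M 0 = target x" "M 1 = num_colors x" "M 2 = num_jobs x"
    and "\<And>v. v < num_jobs x \<Longrightarrow>
      M (job 0 v) = start_of x v \<and> M (job 1 v) = end_of x v \<and> M (job 2 v) = color_of x v"
    and "i < length (encode x)"
  shows "M i = encode x ! i"
proof (cases "i < 3")
  case True
  then show ?thesis using assms(1-3) by (auto simp: encode_def less_Suc_eq numeral_3_eq_3 numeral_2_eq_2)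
next
  case False
  define v j where "v = (i - 3) div 3" and "j = (i - 3) mod 3"
  have i: "i = job j v" "j < 3"
    using False by (auto simp: v_def j_def job_def)
  have "v < num_jobs x" using assms(5) i by (simp add: length_encode job_def)
  with assms(4)[OF this] nth_encode_job[OF this i(2)] i show ?thesis
    by (auto simp: less_Suc_eq numeral_3_eq_3 numeral_2_eq_2)
qed

lemma (in sorted_job_list) kernel_output_encode:
  assumes "kernel_output st" "i < length (encode reduced)"
  shows "snd st i = encode reduced ! i"
  using assms by (intro encode_agrees) (simp_all add: kernel_output_def Let_def)

context proper_job_list
begin

lemma kept_nth: "j < length kept_list \<Longrightarrow> kept_list ! j \<in> set kept_list \<and> kept_list ! j < n"
  using nth_mem[of j kept_list] by (simp add: set_kept_list)

lemma kept_list_less: "i < j \<Longrightarrow> j < length kept_list \<Longrightarrow> kept_list ! i < kept_list ! j"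
  by (rule sorted_wrt_nth_less[of "(<)"]) (simp_all add: kept_list_def kept_def sorted_wrt_filter)

lemma kept_list_eq_iff:
  "i < length kept_list \<Longrightarrow> j < length kept_list \<Longrightarrow> kept_list ! i = kept_list ! j \<longleftrightarrow> i = j"
  using kept_list_less by (metis linorder_neqE_nat less_irrefl)

lemma inj_nth_kept_list: "T \<subseteq> {..<length kept_list} \<Longrightarrow> inj_on ((!) kept_list) T"
  by (rule inj_onI) (metis kept_list_eq_iff lessThan_iff subsetD)

text \<open>Compression is monotone and separates an end from every later start. Comparisons of a
  start with an end are all that decides which intervals meet.\<close>

lemma nm_le_iff:
  assumes "u \<in> set kept_list" "v \<in> set kept_list"
  shows "nm (s u) \<le> nm (e v) \<longleftrightarrow> s u \<le> e v"
proof -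
  have "v < n" using assms(2) by (simp add: set_kept_list)
  then have "0 < e v" using s_pos s_le_e by (meson less_le_trans)
  then show ?thesis
    using compress_mono[of "s u" "e v"] compress_strict[of "e v" "e ` set kept_list" "s u" "s ` set kept_list"] assms
    by (meson imageI linorder_not_less)
qed

lemma reduced_interval: "j < length kept_list \<Longrightarrow> start_of reduced j \<le> end_of reduced j"
  using kept_nth[of j] nm_le_iff[of "kept_list ! j" "kept_list ! j"] s_le_e by simp

lemma verts_reduced [simp]: "verts (jis_graph reduced) = {..<length kept_list}"
  by (simp add: jis_graph_def)

lemma reduced_meet_iff:
  assumes "i < length kept_list" "j < length kept_list"
  shows "{start_of reduced i..end_of reduced i} \<inter> {start_of reduced j..end_of reduced j} \<noteq> {} \<longleftrightarrow>
    meets (kept_list ! i) (kept_list ! j)"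
  using intervals_meet_iff[of "start_of reduced" i "end_of reduced" j] reduced_interval assms kept_nth nm_le_iff
  by (simp add: meets_def)

lemma adj_reduced:
  "adj (jis_graph reduced) i j \<longleftrightarrow>
    i < length kept_list \<and> j < length kept_list \<and> i \<noteq> j \<and> meets (kept_list ! i) (kept_list ! j)"
  unfolding jis_graph_def adj_intersection_graph by (metis reduced_meet_iff reduced_simps(1) lessThan_iff)

lemma nm_range:
  assumes "v \<in> set kept_list"
  shows "nm (s v) \<in> {1..nm n}" "nm (e v) \<in> {1..nm n}"
proof -
  have v: "v < n" using assms by (simp add: set_kept_list)
  have "0 < nm (s v)" using compress_start_pos assms s_pos[OF v] by blast
  moreover have "nm (s v) \<le> nm (e v)" "nm (e v) \<le> nm n"
    using s_le_e[OF v] e_le[OF v] by (simp_all add: compress_mono)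
  ultimately show "nm (s v) \<in> {1..nm n}" "nm (e v) \<in> {1..nm n}" by auto
qed

text \<open>The sweep opens coordinates at start points and leaves them only after end points, as
  the criterion \<open>minimum_representationI\<close> demands.\<close>

lemma reduced_minimum:
  "minimum_representation (jis_graph reduced) (start_of reduced) (end_of reduced)"
proof (rule minimum_representationI)
  show "representation_upto (jis_graph reduced) (nm n) (start_of reduced) (end_of reduced)"
    unfolding representation_upto_def interval_representation_def
    using reduced_interval kept_nth nm_range by (auto simp: jis_graph_def)
next
  fix q assume q: "q \<in> {1..nm n}"
  then obtain v where v: "v \<in> set kept_list" "nm (s v) = q"
    using compress_hits_start[of q "s ` set kept_list" "e ` set kept_list" n] by auto
  then show "\<exists>v\<in>verts (jis_graph reduced). start_of reduced v = q"
    by (auto simp: in_set_conv_nth)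
  have "\<exists>u\<in>set kept_list. nm (e u) = q"
  proof (cases "q < nm n")
    case True
    then show ?thesis
      using compress_hits_end[of q "s ` set kept_list" "e ` set kept_list" n] q by auto
  next
    \<comment> \<open>An interval that starts at the last coordinate cannot end beyond it.\<close>
    case False
    then have "nm (e v) = q"
      using nm_le_iff[OF v(1) v(1)] s_le_e v nm_range[OF v(1)] q by (auto simp: set_kept_list)
    with v show ?thesis by blast
  qed
  then show "\<exists>v\<in>verts (jis_graph reduced). end_of reduced v = q"
    by (auto simp: in_set_conv_nth)
qed simp

text \<open>The restriction of the real representation to the kept intervals is again
  proper.\<close>

lemma reduced_proper_interval: "proper_interval_graph (jis_graph reduced)"
  unfolding proper_interval_graph_def
proof (intro exI conjI)
  have *: "{l (kept_list ! i)..r (kept_list ! i)} \<inter> {l (kept_list ! j)..r (kept_list ! j)} \<noteq> {} \<longleftrightarrow>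
      meets (kept_list ! i) (kept_list ! j)"
    if "i < length kept_list" "j < length kept_list" for i j
    using that kept_nth l_le_r meets_real
    by (subst intervals_meet_iff[of "\<lambda>j. l (kept_list ! j)" _ "\<lambda>j. r (kept_list ! j)"]) auto
  show "interval_representation (jis_graph reduced) (\<lambda>j. l (kept_list ! j)) (\<lambda>j. r (kept_list ! j))"
    unfolding interval_representation_def verts_reduced
  proof
    show "jis_graph reduced = intersection_graph {..<length kept_list}
        (\<lambda>j. l (kept_list ! j)) (\<lambda>j. r (kept_list ! j))"
      unfolding jis_graph_def reduced_simps
      by (rule intersection_graph_cong) (simp only: * reduced_meet_iff lessThan_iff)
  qed (use kept_nth l_le_r in auto)
qed (use kept_nth not_nested in auto)

lemma reduced_sorted: "sorted (map fst (jobs reduced))"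
proof -
  have "nm (s (kept_list ! i)) \<le> nm (s (kept_list ! j))" if "i \<le> j" "j < length kept_list" for i j
    using that kept_list_less[of i j] kept_nth[of j]
    by (intro compress_mono s_mono) (auto simp: le_less)
  then show ?thesis by (auto simp: reduced_def sorted_iff_nth_mono)
qed

lemma reduced_instance:
  assumes "\<And>v. v < n \<Longrightarrow> c v \<in> {1..C}"
  shows "proper_jis_instance reduced"
  unfolding proper_jis_instance_def jis_instance_def
  using reduced_minimum reduced_sorted reduced_proper_interval assms kept_nth by auto

text \<open>Up to renaming, the reduced graph is an induced subgraph of the original one.\<close>

lemma reduced_clique_number: "clique_number (jis_graph reduced) \<le> \<omega>"
proof (rule clique_number_le)
  fix K assume K: "clique (jis_graph reduced) K"
  then have sub: "K \<subseteq> {..<length kept_list}" by (simp add: clique_def)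
  have "inj_on ((!) kept_list) K" using sub by (rule inj_nth_kept_list)
  then have "card K = card ((!) kept_list ` K)" by (simp add: card_image)
  also have "\<dots> \<le> \<omega>"
  proof (rule clique_le)
    show "(!) kept_list ` K \<subseteq> {..<n}" using sub kept_nth by auto
  next
    fix u v assume "u \<in> (!) kept_list ` K" "v \<in> (!) kept_list ` K"
    then obtain i j where ij: "u = kept_list ! i" "v = kept_list ! j" "i \<in> K" "j \<in> K" by blast
    show "meets u v"
    proof (cases "i = j")
      case True
      then show ?thesis using ij sub kept_nth s_le_e by (auto simp: meets_def)
    next
      case False
      then show ?thesis using ij K by (auto simp: clique_def adj_reduced)
    qed
  qed
  finally show "card K \<le> \<omega>" .
qed simp

text \<open>The bijection \<open>(!) kept_list\<close> from positions to kept jobs preserves colors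
  and adjacency.\<close>

lemma reduced_yes_iff: "jis_yes reduced \<longleftrightarrow> (\<exists>S. solution S new_target \<and> S \<subseteq> set kept_list)"
proof
  assume "jis_yes reduced"
  then obtain T where T: "T \<subseteq> {..<length kept_list}" "inj_on (color_of reduced) T"
      "card T = new_target" "\<And>i j. i \<in> T \<Longrightarrow> j \<in> T \<Longrightarrow> i \<noteq> j \<Longrightarrow> \<not> adj (jis_graph reduced) i j"
    by (auto simp: jis_yes_def colorful_independent_def independent_def)
  let ?S = "(!) kept_list ` T"
  have T': "i < length kept_list" if "i \<in> T" for i using that T(1) by auto
  have "inj_on ((!) kept_list) T" using T(1) by (rule inj_nth_kept_list)
  then have "card ?S = new_target" using T(3) by (simp add: card_image)
  moreover have "inj_on c ?S"
    using T(2) T' unfolding inj_on_def by auto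
  moreover have "apart ?S"
    using T(4) T' kept_nth by (auto simp: apart_def adj_reduced)
  ultimately have "solution ?S new_target" by (simp add: solution_def)
  then show "\<exists>S. solution S new_target \<and> S \<subseteq> set kept_list" using T' by fastforce
next
  assume "\<exists>S. solution S new_target \<and> S \<subseteq> set kept_list"
  then obtain S where S: "apart S" "inj_on c S" "card S = new_target" "S \<subseteq> set kept_list"
    by (auto simp: solution_def)
  let ?T = "{j. j < length kept_list \<and> kept_list ! j \<in> S}"
  have img: "S = (!) kept_list ` ?T" using S(4) by (auto simp: image_iff) (metis in_set_conv_nth subsetD)
  have inj: "inj_on ((!) kept_list) ?T" by (rule inj_nth_kept_list) auto
  have "card ?T = new_target" using S(3) card_image[OF inj] img by simp
  moreover have "inj_on (color_of reduced) ?T"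
    by (rule inj_onI) (simp, metis S(2) inj_onD kept_list_eq_iff)
  moreover have "independent (jis_graph reduced) ?T"
    using S(1) by (auto simp: independent_def adj_reduced apart_def kept_list_eq_iff)
  ultimately show "jis_yes reduced"
    unfolding jis_yes_def colorful_independent_def by auto
qed

lemma reduced_size: "card (verts (jis_graph reduced)) \<le> 4 * k\<^sup>2 * \<omega>"
proof -
  have "distinct kept_list" by (simp add: kept_list_def kept_def)
  then show ?thesis using kept_list_le distinct_card by fastforce
qed

end

section \<open>Linear running time and assembly of the result\<close>

lemma kernel_time_bigo: "(\<lambda>n. real (kernel_time n)) \<in> O(\<lambda>n. real n)"
proof -
  obtain A B where AB: "\<And>n. kernel_time n = A * n + B"
  proof
    show "kernel_time n = (cost greedy_body + cost keep_body + cost compress_body + cost remap_body + 4) * n +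
      (cost init_prog + cost mid_prog + cost compress_init + cost remap_init + cost final_prog + 4)" for n
      by (simp add: kernel_time_def algebra_simps)
  qed
  have "eventually (\<lambda>n. norm (real (kernel_time n)) \<le> (A + B) * norm (real n)) at_top"
    using eventually_ge_at_top[of "1 :: nat"]
  proof eventually_elim
    case (elim n)
    \<comment> \<open>For \<open>1 \<le> n\<close> the additive constant is absorbed into the linear
      term.\<close>
    then have "B * 1 \<le> B * n" by (intro mult_le_mono2)
    then have "kernel_time n \<le> (A + B) * n" by (simp add: AB distrib_right)
    then show ?case by (metis norm_of_nat of_nat_mono of_nat_mult)
  qed
  then show ?thesis by (rule bigoI)
qed

lemma kernelization_correct:
  assumes "proper_jis_instance x"
  obtains y where "proper_jis_instance y"
    "runs_within kernel_prog (encode x) (encode y) (kernel_time (num_jobs x))"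
    "jis_yes x \<longleftrightarrow> jis_yes y"
    "card (verts (jis_graph y)) \<le> 4 * (target x)\<^sup>2 * clique_number (jis_graph x)"
    "target y \<le> target x" "clique_number (jis_graph y) \<le> clique_number (jis_graph x)"
    "num_colors y = num_colors x"
proof -
  let ?G = "jis_graph x"
  have verts: "verts ?G = {..<num_jobs x}" by (simp add: jis_graph_def)
  have min: "minimum_representation ?G (start_of x) (end_of x)" and sorted: "sorted (map fst (jobs x))"
    and colors: "\<And>v. v < num_jobs x \<Longrightarrow> color_of x v \<in> {1..num_colors x}"
    using assms verts by (auto simp: proper_jis_instance_def jis_instance_def)
  have rep: "interval_representation ?G (start_of x) (end_of x)"
    and pos: "\<And>v. v < num_jobs x \<Longrightarrow> 0 < start_of x v"
    using min verts by (force simp: minimum_representation_def representation_upto_def)+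
  obtain l r :: "nat \<Rightarrow> real" where lr: "interval_representation ?G l r"
      "\<And>u v. u < num_jobs x \<Longrightarrow> v < num_jobs x \<Longrightarrow> \<not> {l u..r u} \<subset> {l v..r v}"
    using assms verts by (auto simp: proper_jis_instance_def proper_interval_graph_def)
  have le: "start_of x v \<le> end_of x v" "l v \<le> r v" if "v < num_jobs x" for v
    using that rep lr(1) verts unfolding interval_representation_def by blast+
  interpret sorted_job_list "num_jobs x" "target x" "num_colors x" "start_of x" "end_of x" "color_of x"
  proof
    show "end_of x v \<le> num_jobs x" if "v < num_jobs x" for v
      using minimum_representation_end_le[OF _ min, of v] that verts by simp
    show "start_of x u \<le> start_of x v" if "u \<le> v" "v < num_jobs x" for u v
      using sorted_nth_mono[OF sorted that(1)] that by (simp add: start_of_def num_jobs_def)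
  qed (use le pos in auto)
  have adj: "adj ?G u v \<longleftrightarrow> meets u v" if "u < num_jobs x" "v < num_jobs x" "u \<noteq> v" for u v
    using representation_adj[OF rep _ _ that(3)] that verts by (simp add: meets_def)
  \<comment> \<open>The integer and the real representation have the same adjacency, which links
    \<open>meets\<close> to \<open>l\<close> and \<open>r\<close>.\<close>
  interpret proper_job_list "num_jobs x" "target x" "num_colors x" "start_of x" "end_of x" "color_of x"
    "clique_number ?G" l r
  proof
    fix K assume "K \<subseteq> {..<num_jobs x}" "\<And>u v. u \<in> K \<Longrightarrow> v \<in> K \<Longrightarrow> meets u v"
    then have "clique ?G K" using adj verts by (auto simp: clique_def subset_iff)
    then show "card K \<le> clique_number ?G" using verts by (intro clique_le_clique_number) auto
  next
    fix u v assume uv: "u < num_jobs x" "v < num_jobs x"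
    show "meets u v \<longleftrightarrow> l u \<le> r v \<and> l v \<le> r u"
    proof (cases "u = v")
      case True
      then show ?thesis using le uv by (simp add: meets_def)
    next
      case False
      then show ?thesis using adj[OF uv False] representation_adj[OF lr(1) _ _ False] uv verts by simp
    qed
  qed (use le lr(2) in auto)
  have "independent ?G S \<longleftrightarrow> apart S" for S
    unfolding independent_def apart_def verts by (meson adj lessThan_iff subsetD)
  then have yes: "jis_yes x \<longleftrightarrow> (\<exists>S. solution S (target x))"
    by (simp only: jis_yes_def colorful_independent_def solution_def conj_assoc)
  let ?M = "\<lambda>i. if i < length (encode x) then encode x ! i else 0"
  have stored: "stored ?M v v" if "v < num_jobs x" for v
  proof -
    have "job j v < length (encode x)" if "j < 3" for j
      using \<open>v < num_jobs x\<close> that by (simp add: job_def length_encode)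
    then show ?thesis using nth_encode_job[OF that] by (simp add: stored_def)
  qed
  have "input ?M"
    unfolding input_def
  proof (intro conjI allI impI)
    show "?M 0 = target x" "?M 1 = num_colors x" "?M 2 = num_jobs x" by (simp_all add: encode_def)
  qed (use stored length_encode in auto)
  from reaches_kernel_prog[OF this] obtain t R M where "t \<le> kernel_time (num_jobs x)"
      "exec kernel_prog (\<lambda>_. 0, ?M) t (R, M)" "kernel_output (R, M)"
    unfolding reaches_def by auto
  then have "runs_within kernel_prog (encode x) (encode reduced) (kernel_time (num_jobs x))"
    unfolding runs_within_def using kernel_output_encode[of "(R, M)"]
    by (intro exI[of _ t] exI[of _ R] exI[of _ M]) simp
  moreover have "new_target \<le> target x" by (simp add: new_target_def)
  ultimately show thesis
    using that[of reduced] reduced_instance[OF colors] yes solution_iff reduced_yes_iff reduced_size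
      reduced_clique_number by simp
qed

theorem theorem6:
  shows "\<exists>(p :: com) (T :: nat \<Rightarrow> nat).
    (\<lambda>n. real (T n)) \<in> O(\<lambda>n. real n) \<and>
    computes_jis_kernel p T (\<lambda>x. 4 * (target x)\<^sup>2 * clique_number (jis_graph x))"
proof (intro exI conjI)
  show "computes_jis_kernel kernel_prog kernel_time
    (\<lambda>x. 4 * (target x)\<^sup>2 * clique_number (jis_graph x))"
    unfolding computes_jis_kernel_def
  \<comment> \<open>Neither parameter increases, so the sum bounds both of them; the number of
    colors is unchanged.\<close>
  proof (intro exI[of _ "\<lambda>k w. k + w"] exI[of _ "\<lambda>k w m. m"] allI impI)
    fix x assume "proper_jis_instance x"
    then show "\<exists>x'. proper_jis_instance x' \<and>
          runs_within kernel_prog (encode x) (encode x') (kernel_time (num_jobs x)) \<and>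
          (jis_yes x \<longleftrightarrow> jis_yes x') \<and>
          card (verts (jis_graph x')) \<le> 4 * (target x)\<^sup>2 * clique_number (jis_graph x) \<and>
          target x' \<le> target x + clique_number (jis_graph x) \<and>
          clique_number (jis_graph x') \<le> target x + clique_number (jis_graph x) \<and>
          num_colors x' \<le> num_colors x"
      by (rule kernelization_correct) (metis order_refl trans_le_add1 trans_le_add2)
  qed
qed (rule kernel_time_bigo)

end
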